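(* Let $M = D_X u$ be a left $D_X$-module generated by an element $u \in M$, let $f \in K[x]$ be a non-constant polynomial, and let $\lambda \in K$. Assume that the (generalized) $b$-function $b_{u,f}(s)$ for $u$ and $f$ exists. Then the following conditions are equivalent: (1) $b_{u,f}(\lambda - k) \neq 0$ for every positive integer $k$. (2) $M\otimes_{K[x]}K[x,f^{-1}]f^\lambda$ is generated by $u\otimes f^\lambda$ over $D_X$.
   Context: $K$ is a field of characteristic zero, $K[x]=K[x_1,\dots,x_n]$, $X=K^n$, and $D_X = K[x]\langle\partial_{x_1},\dots,\partial_{x_n}\rangle$ is the $n$-th Weyl algebra. Put $f_i=\partial f/\partial x_i$. Let $s$ be an indeterminate commuting with $D_X$, and let $\mathcal{L}=K[x,f^{-1},s]f^s$ be the free $K[x,f^{-1},s]$-module with free generator $f^s$, made into a left $D_X[s]$-module by $\partial_{x_i}(a(x,s)f^{-k}f^s)=\left(\frac{\partial a(x,s)}{\partial x_i}f^{-k}+(s-k)f_i a(x,s)f^{-k-1}\right)f^s$. The tensor product $M\otimes_{K[x]}\mathcal{L}$ is a left $D_X[s]$-module via the Leibniz rule $\partial_{x_i}(v\otimes w)=(\partial_{x_i}v)\otimes w+v\otimes\partial_{x_i}w$. For $k\in\mathbb{Z}$, $f^{s+k}$ denotes $f^kf^s$. The $b$-function $b_{u,f}(s)$ is the monic polynomial $b(s)\in K[s]$ of least degree such that $b(s)(u\otimes f^s)\in D_X[s](u\otimes f^{s+1})$ in $M\otimes_{K[x]}\mathcal{L}$; it is said to exist if there is a nonzero $b(s)\in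 K[s]$ with this property. For $\lambda\in K$, $K[x,f^{-1}]f^\lambda$ is the free $K[x,f^{-1}]$-module with free generator $f^\lambda$, with left $D_X$-module structure $\partial_{x_i}(a(x)f^{-k}f^\lambda)=\left(\frac{\partial a(x)}{\partial x_i}f^{-k}+(\lambda-k)f_ia(x)f^{-k-1}\right)f^\lambda$; $M\otimes_{K[x]}K[x,f^{-1}]f^\lambda$ is a left $D_X$-module via the Leibniz rule. *)

theory Defs
  imports
    Complex_Main
    "HOL-Library.Poly_Mapping"
    "HOL-Computational_Algebra.Polynomial"
    "HOL-Computational_Algebra.Fraction_Field"
begin

section \<open>Multivariate polynomials and partial derivatives\<close>

text \<open>
  The variables are indexed by a finite linearly ordered type \<open>'n\<close>; thus \<open>n = CARD('n)\<close>.
\<close>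

abbreviation "keys \<equiv> Poly_Mapping.keys"
abbreviation "lookup \<equiv> Poly_Mapping.lookup"
abbreviation "single \<equiv> Poly_Mapping.single"

type_synonym ('n, 'k) mpoly = "('n \<Rightarrow>\<^sub>0 nat) \<Rightarrow>\<^sub>0 'k"

definition mconst :: "'k \<Rightarrow> ('n, 'k::zero) mpoly" where
  "mconst c = single 0 c"

definition mderiv :: "'n \<Rightarrow> ('n, 'k) mpoly \<Rightarrow> ('n, 'k::comm_semiring_1) mpoly" where
  "mderiv i p = (\<Sum>m\<in>keys p. single (m - single i 1) (of_nat (lookup m i) * lookup p m))"

lemma pm_induct [case_names zero single add]:
  assumes "P 0" "\<And>k c. P (single k c)" "\<And>p q. P p \<Longrightarrow> P q \<Longrightarrow> P (p + q)"
  shows "P (p :: 'a \<Rightarrow>\<^sub>0 'b::comm_monoid_add)"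
proof -
  have "P (\<Sum>k\<in>A. single k (lookup p k))" if "finite A" for A
    using that by (induction A) (auto intro: assms)
  moreover have "(\<Sum>k\<in>keys p. single k (lookup p k)) = p"
    by (rule poly_mapping_eqI)
      (auto simp: lookup_sum lookup_single when_def in_keys_iff intro: sum.neutral)
  ultimately show ?thesis by (metis finite_keys)
qed

lemma mderiv_zero [simp]: "mderiv i 0 = 0"
  by (simp add: mderiv_def)

lemma mderiv_add: "mderiv i (p + q) = mderiv i p + mderiv i q"
  unfolding mderiv_def
  by (rule setsum_keys_plus_distrib) (simp_all add: distrib_left single_add)

lemma mderiv_single:
  "mderiv i (single m c) = single (m - single i 1) (of_nat (lookup m i) * c)"
  by (simp add: mderiv_def)

lemma mderiv_diff: "mderiv i (p - q) = mderiv i p - mderiv i (q :: ('n, 'k::comm_ring_1) mpoly)"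
  by (metis mderiv_add add_diff_cancel diff_add_cancel)

lemma mderiv_uminus: "mderiv i (- q) = - mderiv i (q :: ('n, 'k::comm_ring_1) mpoly)"
  using mderiv_diff[of i 0 q] by simp

lemma mderiv_mconst [simp]: "mderiv i (mconst c) = 0"
  by (simp add: mconst_def mderiv_single)

lemma mderiv_one [simp]: "mderiv i 1 = 0"
  using mderiv_mconst[of i 1] by (simp add: mconst_def)

lemma exp_shift:
  fixes m m' :: "'n \<Rightarrow>\<^sub>0 nat"
  assumes "lookup m i \<noteq> 0"
  shows "m - single i 1 + m' = m + m' - single i 1"
  using assms by (intro poly_mapping_eqI) (auto simp: lookup_add lookup_minus lookup_single when_def)

lemma mderiv_mult: "mderiv i (p * q) = mderiv i p * q + p * mderiv i q"
proof (induction p rule: pm_induct)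
  case (single m c)
  show ?case
  proof (induction q rule: pm_induct)
    case (single m' c')
    have 1: "single (m - single i 1 + m') (of_nat (lookup m i) * c * c')
      = single (m + m' - single i 1) (of_nat (lookup m i) * c * c')"
      using exp_shift[of m i m'] by (cases "lookup m i = 0") auto
    have 2: "single (m + (m' - single i 1)) (c * (of_nat (lookup m' i) * c'))
      = single (m + m' - single i 1) (c * (of_nat (lookup m' i) * c'))"
      using exp_shift[of m' i m] by (cases "lookup m' i = 0") (auto simp: add.commute)
    show ?case
      unfolding mderiv_single mult_single 1 2
      by (simp add: lookup_add algebra_simps flip: single_add)
  qed (simp_all add: mderiv_add algebra_simps)
qed (simp_all add: mderiv_add algebra_simps)

lemma mderiv_commute: "mderiv i (mderiv j p) = mderiv j (mderiv i p)"
proof (induction p rule: pm_induct)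
  case (single m c)
  have "m - single j 1 - single i 1 = m - single i 1 - single j (1::nat)"
    by (rule poly_mapping_eqI) (simp add: lookup_minus)
  then show ?case
    by (cases "i = j") (simp_all add: mderiv_single lookup_minus lookup_single mult.left_commute)
qed (simp_all add: mderiv_add)


section \<open>The Weyl algebra\<close>

text \<open>
  An operator \<open>\<Sum>\<^sub>\<beta> a\<^sub>\<beta> \<partial>\<^sup>\<beta>\<close> is stored as the map \<open>\<beta> \<mapsto> a\<^sub>\<beta>\<close>.  Such a normal form acts on everything on
  which polynomials and the \<open>\<partial>\<^sub>i\<close> act; the product of the Weyl algebra is the action of normal
  forms on normal forms, where \<open>\<partial>\<^sub>i (\<Sum>\<^sub>\<beta> a\<^sub>\<beta> \<partial>\<^sup>\<beta>) = \<Sum>\<^sub>\<beta> (\<partial>a\<^sub>\<beta>/\<partial>x\<^sub>i) \<partial>\<^sup>\<beta> + \<Sum>\<^sub>\<beta> a\<^sub>\<beta> \<partial>\<^sub>i\<partial>\<^sup>\<beta>\<close>.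
\<close>

type_synonym ('n, 'k) nform = "('n \<Rightarrow>\<^sub>0 nat) \<Rightarrow>\<^sub>0 ('n, 'k) mpoly"

definition dpow :: "('n::{finite,linorder} \<Rightarrow> 'v \<Rightarrow> 'v) \<Rightarrow> ('n \<Rightarrow>\<^sub>0 nat) \<Rightarrow> 'v \<Rightarrow> 'v" where
  "dpow d \<beta> = foldr (\<lambda>i. d i ^^ lookup \<beta> i) (sorted_list_of_set UNIV)"

lemma dpow_zero [simp]: "dpow d 0 v = v"
proof -
  have "foldr (\<lambda>i. d i ^^ lookup 0 i) xs v = v" for xs by (induction xs) auto
  then show ?thesis by (simp add: dpow_def)
qed

definition nf_act ::
  "(('n, 'k) mpoly \<Rightarrow> 'v \<Rightarrow> 'v) \<Rightarrow> ('n \<Rightarrow> 'v \<Rightarrow> 'v) \<Rightarrow> ('n::{finite,linorder}, 'k::zero) nform \<Rightarrow> 'v \<Rightarrow> 'v::ab_group_add" where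
  "nf_act sm d P v = (\<Sum>\<beta>\<in>keys P. sm (lookup P \<beta>) (dpow d \<beta> v))"

definition nf_scale :: "('n, 'k) mpoly \<Rightarrow> ('n, 'k) nform \<Rightarrow> ('n, 'k::comm_ring_1) nform" where
  "nf_scale a Q = Poly_Mapping.map ((*) a) Q"

definition nf_d :: "'n \<Rightarrow> ('n, 'k) nform \<Rightarrow> ('n, 'k::comm_ring_1) nform" where
  "nf_d i Q = Poly_Mapping.map (mderiv i) Q
     + (\<Sum>\<beta>\<in>keys Q. single (\<beta> + single i 1) (lookup Q \<beta>))"

definition nf_mult :: "('n::{finite,linorder}, 'k::comm_ring_1) nform \<Rightarrow> ('n, 'k) nform \<Rightarrow> ('n, 'k) nform" where
  "nf_mult P Q = nf_act nf_scale nf_d P Q"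

text \<open>
  Polynomials and derivations acting on \<open>C / N\<close> subject to the relations of the Weyl algebra.
\<close>

locale weyl_rep =
  fixes N C :: "'v::ab_group_add set"
    and sm :: "('n::{finite,linorder}, 'k::comm_ring_1) mpoly \<Rightarrow> 'v \<Rightarrow> 'v"
    and d :: "'n \<Rightarrow> 'v \<Rightarrow> 'v"
  assumes N0: "0 \<in> N" and Nd: "x \<in> N \<Longrightarrow> y \<in> N \<Longrightarrow> x - y \<in> N"
    and C0: "0 \<in> C" and Cd: "x \<in> C \<Longrightarrow> y \<in> C \<Longrightarrow> x - y \<in> C"
    and sm_add: "sm a (x + y) = sm a x + sm a y"
    and d_add: "d i (x + y) = d i x + d i y"
    and sm_N: "x \<in> N \<Longrightarrow> sm a x \<in> N" and d_N: "x \<in> N \<Longrightarrow> d i x \<in> N"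
    and sm_C: "x \<in> C \<Longrightarrow> sm a x \<in> C" and d_C: "x \<in> C \<Longrightarrow> d i x \<in> C"
    and sm_add_left: "x \<in> C \<Longrightarrow> sm (a + b) x - (sm a x + sm b x) \<in> N"
    and sm_mult: "x \<in> C \<Longrightarrow> sm (a * b) x - sm a (sm b x) \<in> N"
    and d_sm: "x \<in> C \<Longrightarrow> d i (sm a x) - (sm (mderiv i a) x + sm a (d i x)) \<in> N"
    and d_comm: "x \<in> C \<Longrightarrow> d i (d j x) - d j (d i x) \<in> N"
begin

definition eqv (infix \<open>\<sim>\<close> 50) where "x \<sim> y \<longleftrightarrow> x - y \<in> N"

lemma N_uminus: "x \<in> N \<Longrightarrow> - x \<in> N" using Nd[OF N0] by simp
lemma N_add: "x \<in> N \<Longrightarrow> y \<in> N \<Longrightarrow> x + y \<in> N" using Nd[of x "-y"] N_uminus by simp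
lemma C_uminus: "x \<in> C \<Longrightarrow> - x \<in> C" using Cd[OF C0] by simp
lemma C_add: "x \<in> C \<Longrightarrow> y \<in> C \<Longrightarrow> x + y \<in> C" using Cd[of x "-y"] C_uminus by simp
lemma C_sum: "(\<And>i. i \<in> I \<Longrightarrow> f i \<in> C) \<Longrightarrow> sum f I \<in> C"
  by (induction I rule: infinite_finite_induct) (auto intro: C0 C_add)
lemma N_sum: "(\<And>i. i \<in> I \<Longrightarrow> f i \<in> N) \<Longrightarrow> sum f I \<in> N"
  by (induction I rule: infinite_finite_induct) (auto intro: N0 N_add)

lemma eqv_refl [simp]: "x \<sim> x" by (simp add: eqv_def N0)
lemma eqv_sym: "x \<sim> y \<Longrightarrow> y \<sim> x"
  unfolding eqv_def using N_uminus[of "x - y"] by simp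
lemma eqv_trans [trans]: "x \<sim> y \<Longrightarrow> y \<sim> z \<Longrightarrow> x \<sim> z"
  unfolding eqv_def using N_add[of "x - y" "y - z"] by simp
lemma eqv_add: "x \<sim> x' \<Longrightarrow> y \<sim> y' \<Longrightarrow> x + y \<sim> x' + y'"
  unfolding eqv_def using N_add[of "x - x'" "y - y'"] by (simp add: algebra_simps)
lemma eqv_sum: "(\<And>i. i \<in> I \<Longrightarrow> f i \<sim> g i) \<Longrightarrow> sum f I \<sim> sum g I"
  unfolding eqv_def by (simp add: N_sum flip: sum_subtractf)

lemma sm_zero [simp]: "sm a 0 = 0" using sm_add[of a 0 0] by simp
lemma d_zero [simp]: "d i 0 = 0" using d_add[of i 0 0] by simp
lemma sm_diff: "sm a (x - y) = sm a x - sm a y" by (metis sm_add add_diff_cancel diff_add_cancel)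
lemma d_diff: "d i (x - y) = d i x - d i y" by (metis d_add add_diff_cancel diff_add_cancel)
lemma sm_sum: "sm a (sum f I) = (\<Sum>i\<in>I. sm a (f i))"
  by (induction I rule: infinite_finite_induct) (auto simp: sm_add)
lemma d_sum: "d i (sum f I) = (\<Sum>j\<in>I. d i (f j))"
  by (induction I rule: infinite_finite_induct) (auto simp: d_add)
lemma sm_eqv: "x \<sim> y \<Longrightarrow> sm a x \<sim> sm a y" unfolding eqv_def using sm_N by (simp flip: sm_diff)
lemma d_eqv: "x \<sim> y \<Longrightarrow> d i x \<sim> d i y" unfolding eqv_def using d_N by (simp flip: d_diff)
lemma sm_zero_left: "x \<in> C \<Longrightarrow> sm 0 x \<sim> 0"
  using sm_add_left[of x 0 0] N_uminus[of "- sm 0 x"] by (simp add: eqv_def)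

lemma dp_C: "x \<in> C \<Longrightarrow> (d i ^^ k) x \<in> C" by (induction k) (auto intro: d_C)
lemma dp_N: "x \<in> N \<Longrightarrow> (d i ^^ k) x \<in> N" by (induction k) (auto intro: d_N)
lemma dp_add: "(d i ^^ k) (x + y) = (d i ^^ k) x + (d i ^^ k) y" by (induction k) (auto simp: d_add)
lemma dp_diff: "(d i ^^ k) (x - y) = (d i ^^ k) x - (d i ^^ k) y" by (induction k) (auto simp: d_diff)
lemma dp_eqv: "x \<sim> y \<Longrightarrow> (d i ^^ k) x \<sim> (d i ^^ k) y" by (induction k) (auto intro: d_eqv)
lemma dp_comm: "x \<in> C \<Longrightarrow> (d i ^^ k) (d j x) \<sim> d j ((d i ^^ k) x)"
proof (induction k)
  case (Suc k)
  have "d i ((d i ^^ k) (d j x)) \<sim> d i (d j ((d i ^^ k) x))" using Suc by (intro d_eqv) auto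
  also have "\<dots> \<sim> d j (d i ((d i ^^ k) x))" using d_comm Suc.prems dp_C by (simp add: eqv_def)
  finally show ?case by simp
qed simp

definition dpl :: "'n list \<Rightarrow> ('n \<Rightarrow>\<^sub>0 nat) \<Rightarrow> 'v \<Rightarrow> 'v" where
  "dpl xs \<beta> = foldr (\<lambda>i. d i ^^ lookup \<beta> i) xs"

lemma dpl_simps [simp]: "dpl [] \<beta> x = x" "dpl (i # xs) \<beta> x = (d i ^^ lookup \<beta> i) (dpl xs \<beta> x)"
  by (simp_all add: dpl_def)
lemma dpl_C: "x \<in> C \<Longrightarrow> dpl xs \<beta> x \<in> C" by (induction xs) (auto intro: dp_C)
lemma dpl_N: "x \<in> N \<Longrightarrow> dpl xs \<beta> x \<in> N" by (induction xs) (auto intro: dp_N)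
lemma dpl_add: "dpl xs \<beta> (x + y) = dpl xs \<beta> x + dpl xs \<beta> y" by (induction xs) (auto simp: dp_add)
lemma dpl_notin: "i \<notin> set xs \<Longrightarrow> dpl xs (\<beta> + single i 1) x = dpl xs \<beta> x"
  by (induction xs) (auto simp: lookup_add lookup_single when_def)
lemma dpl_step:
  assumes "distinct xs" "i \<in> set xs" "x \<in> C"
  shows "dpl xs (\<beta> + single i 1) x \<sim> d i (dpl xs \<beta> x)"
  using assms
proof (induction xs)
  case (Cons j xs)
  show ?case
  proof (cases "j = i")
    case True
    then show ?thesis using Cons.prems dpl_notin[of i xs \<beta> x]
      by (simp add: lookup_add lookup_single)
  next
    case False
    have "(d j ^^ lookup \<beta> j) (dpl xs (\<beta> + single i 1) x)
        \<sim> (d j ^^ lookup \<beta> j) (d i (dpl xs \<beta> x))"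
      using Cons False by (intro dp_eqv) auto
    also have "\<dots> \<sim> d i ((d j ^^ lookup \<beta> j) (dpl xs \<beta> x))"
      using dp_comm Cons.prems dpl_C by blast
    finally show ?thesis using False by (simp add: lookup_add lookup_single)
  qed
qed simp

lemma dpow_dpl: "dpow d \<beta> = dpl (sorted_list_of_set UNIV) \<beta>" by (simp add: dpow_def dpl_def)
lemma dpow_C: "x \<in> C \<Longrightarrow> dpow d \<beta> x \<in> C" by (simp add: dpow_dpl dpl_C)
lemma dpow_N: "x \<in> N \<Longrightarrow> dpow d \<beta> x \<in> N" by (simp add: dpow_dpl dpl_N)
lemma dpow_add: "dpow d \<beta> (x + y) = dpow d \<beta> x + dpow d \<beta> y" by (simp add: dpow_dpl dpl_add)
lemma dpow_step: "x \<in> C \<Longrightarrow> dpow d (\<beta> + single i 1) x \<sim> d i (dpow d \<beta> x)"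
  unfolding dpow_dpl by (rule dpl_step) auto

abbreviation act where "act \<equiv> nf_act sm d"

lemma act_C: "x \<in> C \<Longrightarrow> act P x \<in> C" unfolding nf_act_def by (intro C_sum sm_C dpow_C)
lemma act_N: "x \<in> N \<Longrightarrow> act P x \<in> N" unfolding nf_act_def by (intro N_sum sm_N dpow_N)
lemma act_add: "act P (x + y) = act P x + act P y"
  unfolding nf_act_def by (simp add: dpow_add sm_add sum.distrib)
lemma act_diff: "act P (x - y) = act P x - act P y" by (metis act_add add_diff_cancel diff_add_cancel)
lemma act_eqv: "x \<sim> y \<Longrightarrow> act P x \<sim> act P y" unfolding eqv_def using act_N by (simp flip: act_diff)

lemma act_supset:
  assumes "finite A" "keys P \<subseteq> A" "x \<in> C"
  shows "act P x \<sim> (\<Sum>\<beta>\<in>A. sm (lookup P \<beta>) (dpow d \<beta> x))"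
proof -
  have "(\<Sum>\<beta>\<in>A. sm (lookup P \<beta>) (dpow d \<beta> x)) = act P x + (\<Sum>\<beta>\<in>A - keys P. sm (lookup P \<beta>) (dpow d \<beta> x))"
    unfolding nf_act_def by (subst sum.subset_diff[OF assms(2,1)]) (rule add.commute)
  moreover have "(\<Sum>\<beta>\<in>A - keys P. sm (lookup P \<beta>) (dpow d \<beta> x)) \<sim> (\<Sum>\<beta>\<in>A - keys P. 0)"
    using assms(3) by (intro eqv_sum) (auto simp: in_keys_iff intro!: sm_zero_left dpow_C)
  ultimately have "(\<Sum>\<beta>\<in>A. sm (lookup P \<beta>) (dpow d \<beta> x)) \<sim> act P x"
    using eqv_add[OF eqv_refl, of _ 0 "act P x"] by simp
  then show ?thesis by (rule eqv_sym)
qed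

lemma act_zero: "act 0 x = 0" by (simp add: nf_act_def)

lemma act_add_left:
  assumes "x \<in> C"
  shows "act (P + Q) x \<sim> act P x + act Q x"
proof -
  let ?A = "keys P \<union> keys Q"
  have "act (P + Q) x \<sim> (\<Sum>\<beta>\<in>?A. sm (lookup (P + Q) \<beta>) (dpow d \<beta> x))"
    using assms by (intro act_supset) (auto simp: Poly_Mapping.keys_add)
  also have "\<dots> \<sim> (\<Sum>\<beta>\<in>?A. sm (lookup P \<beta>) (dpow d \<beta> x) + sm (lookup Q \<beta>) (dpow d \<beta> x))"
    using assms sm_add_left dpow_C by (intro eqv_sum) (simp add: lookup_add eqv_def)
  also have "\<dots> \<sim> act P x + act Q x"
    unfolding sum.distrib using assms by (intro eqv_add eqv_sym[OF act_supset]) auto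
  finally show ?thesis .
qed

lemma act_sum_left:
  assumes "x \<in> C"
  shows "act (sum F I) x \<sim> (\<Sum>i\<in>I. act (F i) x)"
proof (induction I rule: infinite_finite_induct)
  case (insert i I)
  have "act (F i + sum F I) x \<sim> act (F i) x + act (sum F I) x" using act_add_left assms .
  also have "\<dots> \<sim> act (F i) x + (\<Sum>i\<in>I. act (F i) x)" using insert by (intro eqv_add) auto
  finally show ?case using insert by simp
qed (auto simp: act_zero)

lemma act_single: "x \<in> C \<Longrightarrow> act (single \<beta> a) x \<sim> sm a (dpow d \<beta> x)"
  using sm_zero_left[OF dpow_C, of x \<beta>] eqv_sym by (cases "a = 0") (auto simp: nf_act_def)

lemma act_scale:
  assumes "x \<in> C"
  shows "act (nf_scale a Q) x \<sim> sm a (act Q x)"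
proof -
  have "act (nf_scale a Q) x \<sim> (\<Sum>\<beta>\<in>keys Q. sm (lookup (nf_scale a Q) \<beta>) (dpow d \<beta> x))"
    using assms by (intro act_supset) (auto simp: nf_scale_def in_keys_iff Poly_Mapping.map.rep_eq when_def)
  also have "\<dots> \<sim> (\<Sum>\<beta>\<in>keys Q. sm a (sm (lookup Q \<beta>) (dpow d \<beta> x)))"
    using assms sm_mult dpow_C
    by (intro eqv_sum) (auto simp: nf_scale_def Poly_Mapping.map.rep_eq in_keys_iff eqv_def)
  also have "\<dots> = sm a (act Q x)" by (simp add: nf_act_def sm_sum)
  finally show ?thesis .
qed

lemma act_d:
  assumes "x \<in> C"
  shows "act (nf_d i Q) x \<sim> d i (act Q x)"
proof -
  let ?D = "\<lambda>\<beta>. dpow d \<beta> x"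
  let ?e = "\<lambda>\<beta>. \<beta> + single i 1"
  have 1: "act (Poly_Mapping.map (mderiv i) Q) x \<sim> (\<Sum>\<beta>\<in>keys Q. sm (mderiv i (lookup Q \<beta>)) (?D \<beta>))"
  proof -
    have "act (Poly_Mapping.map (mderiv i) Q) x
        \<sim> (\<Sum>\<beta>\<in>keys Q. sm (lookup (Poly_Mapping.map (mderiv i) Q) \<beta>) (?D \<beta>))"
      using assms by (intro act_supset) (auto simp: in_keys_iff Poly_Mapping.map.rep_eq when_def)
    also have "\<dots> = (\<Sum>\<beta>\<in>keys Q. sm (mderiv i (lookup Q \<beta>)) (?D \<beta>))"
      by (intro sum.cong) (auto simp: Poly_Mapping.map.rep_eq in_keys_iff)
    finally show ?thesis .
  qed
  have 2: "act (\<Sum>\<beta>\<in>keys Q. single (?e \<beta>) (lookup Q \<beta>)) x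
      \<sim> (\<Sum>\<beta>\<in>keys Q. sm (lookup Q \<beta>) (d i (?D \<beta>)))"
  proof -
    have "act (\<Sum>\<beta>\<in>keys Q. single (?e \<beta>) (lookup Q \<beta>)) x
       \<sim> (\<Sum>\<beta>\<in>keys Q. act (single (?e \<beta>) (lookup Q \<beta>)) x)"
      using act_sum_left assms .
    also have "\<dots> \<sim> (\<Sum>\<beta>\<in>keys Q. sm (lookup Q \<beta>) (dpow d (?e \<beta>) x))"
      using act_single assms by (intro eqv_sum)
    also have "\<dots> \<sim> (\<Sum>\<beta>\<in>keys Q. sm (lookup Q \<beta>) (d i (?D \<beta>)))"
      using dpow_step assms by (intro eqv_sum sm_eqv)
    finally show ?thesis .
  qed
  have "act (nf_d i Q) x \<sim> act (Poly_Mapping.map (mderiv i) Q) x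
      + act (\<Sum>\<beta>\<in>keys Q. single (?e \<beta>) (lookup Q \<beta>)) x"
    unfolding nf_d_def by (rule act_add_left) fact
  also have "\<dots> \<sim> (\<Sum>\<beta>\<in>keys Q. sm (mderiv i (lookup Q \<beta>)) (?D \<beta>) + sm (lookup Q \<beta>) (d i (?D \<beta>)))"
    unfolding sum.distrib using 1 2 by (rule eqv_add)
  also have "\<dots> \<sim> (\<Sum>\<beta>\<in>keys Q. d i (sm (lookup Q \<beta>) (?D \<beta>)))"
    by (rule eqv_sum, rule eqv_sym) (use d_sm assms dpow_C in \<open>simp add: eqv_def\<close>)
  also have "\<dots> = d i (act Q x)" by (simp add: nf_act_def d_sum)
  finally show ?thesis .
qed

lemma act_dp: "x \<in> C \<Longrightarrow> act ((nf_d i ^^ k) Q) x \<sim> (d i ^^ k) (act Q x)"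
proof (induction k)
  case (Suc k)
  have "act (nf_d i ((nf_d i ^^ k) Q)) x \<sim> d i (act ((nf_d i ^^ k) Q) x)" using act_d Suc.prems .
  also have "\<dots> \<sim> d i ((d i ^^ k) (act Q x))" using Suc by (intro d_eqv)
  finally show ?case by simp
qed simp

lemma act_dpow:
  assumes "x \<in> C"
  shows "act (dpow nf_d \<beta> Q) x \<sim> dpow d \<beta> (act Q x)"
proof -
  have "act (foldr (\<lambda>i. nf_d i ^^ lookup \<beta> i) xs Q) x \<sim> dpl xs \<beta> (act Q x)" for xs
  proof (induction xs)
    case (Cons i xs)
    have "act ((nf_d i ^^ lookup \<beta> i) (foldr (\<lambda>i. nf_d i ^^ lookup \<beta> i) xs Q)) x
        \<sim> (d i ^^ lookup \<beta> i) (act (foldr (\<lambda>i. nf_d i ^^ lookup \<beta> i) xs Q) x)"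
      using act_dp assms .
    also have "\<dots> \<sim> (d i ^^ lookup \<beta> i) (dpl xs \<beta> (act Q x))" using Cons by (rule dp_eqv)
    finally show ?case by simp
  qed simp
  then show ?thesis by (simp add: dpow_dpl dpow_def[of nf_d])
qed

lemma act_mult:
  assumes "x \<in> C"
  shows "act (nf_mult P Q) x \<sim> act P (act Q x)"
proof -
  have "act (nf_mult P Q) x \<sim> (\<Sum>\<beta>\<in>keys P. act (nf_scale (lookup P \<beta>) (dpow nf_d \<beta> Q)) x)"
    unfolding nf_mult_def nf_act_def[of nf_scale nf_d] using act_sum_left assms .
  also have "\<dots> \<sim> (\<Sum>\<beta>\<in>keys P. sm (lookup P \<beta>) (act (dpow nf_d \<beta> Q) x))"
    using act_scale assms by (intro eqv_sum)
  also have "\<dots> \<sim> (\<Sum>\<beta>\<in>keys P. sm (lookup P \<beta>) (dpow d \<beta> (act Q x)))"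
    using act_dpow assms by (intro eqv_sum sm_eqv)
  also have "\<dots> = act P (act Q x)" by (simp add: nf_act_def)
  finally show ?thesis .
qed

end

lemma nf_scale_eq: "nf_scale a Q = single 0 a * Q"
  by (simp add: nf_scale_def mult_map_scale_conv_mult)

lemma map_mderiv_add: "Poly_Mapping.map (mderiv i) (P + Q) = Poly_Mapping.map (mderiv i) P + Poly_Mapping.map (mderiv i) Q"
  by (rule poly_mapping_eqI) (auto simp: Poly_Mapping.map.rep_eq lookup_add mderiv_add when_def simp flip: mderiv_add)

lemma nf_d_add: "nf_d i (P + Q) = nf_d i P + nf_d i Q"
  unfolding nf_d_def map_mderiv_add
  by (subst setsum_keys_plus_distrib) (simp_all add: single_add)

lemma nf_d_zero [simp]: "nf_d i 0 = 0"
  using nf_d_add[of i 0 0] by simp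

lemma nf_d_single: "nf_d i (single \<beta> a)
   = single \<beta> (mderiv i a) + single (\<beta> + single i 1) a"
  by (simp add: nf_d_def)

interpretation nf: weyl_rep "{0}" UNIV nf_scale "nf_d :: 'n::{finite,linorder} \<Rightarrow> ('n, 'k::comm_ring_1) nform \<Rightarrow> _"
proof unfold_locales
  fix a b :: "('n, 'k) mpoly" and x y :: "('n, 'k) nform" and i j :: 'n
  show "nf_d i (nf_scale a x) - (nf_scale (mderiv i a) x + nf_scale a (nf_d i x)) \<in> {0}"
  proof (induction x rule: pm_induct)
    case (single \<beta> c)
    show ?case by (simp add: nf_scale_eq nf_d_single mult_single mderiv_mult algebra_simps single_add)
  next
    case (add p q)
    then show ?case by (simp add: nf_scale_eq nf_d_add algebra_simps)
  qed (simp add: nf_scale_eq)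
  show "nf_d i (nf_d j x) - nf_d j (nf_d i x) \<in> {0}"
    by (induction x rule: pm_induct)
      (simp_all add: nf_d_single nf_d_add mderiv_commute[of i j] ac_simps)
qed (simp_all add: nf_d_add nf_scale_eq single_add distrib_left distrib_right mult_single flip: mult.assoc)

lemma nf_eqv [simp]: "nf.eqv x y \<longleftrightarrow> x = y"
  by (simp add: nf.eqv_def)

lemma nf_mult_one: "nf_mult (P :: ('n::{finite,linorder}, 'k::comm_ring_1) nform) (single 0 1) = P"
proof -
  have p: "(nf_d i ^^ k) (single \<beta> 1) = single (\<beta> + single i k) (1 :: ('n,'k) mpoly)"
    for \<beta> i k by (induction k) (simp_all add: nf_d_single ac_simps flip: single_add)
  have "nf.dpl xs \<beta> (single 0 1) = single (\<Sum>i\<leftarrow>xs. single i (lookup \<beta> i)) (1 :: ('n,'k) mpoly)"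
    for xs :: "'n list" and \<beta> by (induction xs) (auto simp: p add.commute)
  moreover have "(\<Sum>i\<leftarrow>sorted_list_of_set UNIV. single i (lookup \<beta> i)) = \<beta>" for \<beta> :: "'n \<Rightarrow>\<^sub>0 nat"
    by (subst sum_list_distinct_conv_sum_set)
      (auto intro!: poly_mapping_eqI simp: lookup_sum lookup_single when_def)
  ultimately have "dpow nf_d \<beta> (single 0 1) = single \<beta> (1 :: ('n,'k) mpoly)" for \<beta> :: "'n \<Rightarrow>\<^sub>0 nat"
    by (simp add: nf.dpow_dpl)
  then have "nf_mult P (single 0 1) = (\<Sum>\<beta>\<in>keys P. single \<beta> (lookup P \<beta>))"
    by (simp add: nf_mult_def nf_act_def nf_scale_eq mult_single)
  also have "\<dots> = P"
    by (rule poly_mapping_eqI)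
      (auto simp: lookup_sum lookup_single when_def in_keys_iff intro: sum.neutral)
  finally show ?thesis .
qed

typedef (overloaded) ('n, 'k) weyl = "UNIV :: ('n, 'k::zero) nform set"
  morphisms weyl_nf Weyl by simp

setup_lifting type_definition_weyl

instantiation weyl :: ("{finite,linorder}", comm_ring_1) ring_1
begin

lift_definition zero_weyl :: "('a, 'b) weyl" is 0 .
lift_definition one_weyl :: "('a, 'b) weyl" is "single 0 1" .
lift_definition plus_weyl :: "('a, 'b) weyl \<Rightarrow> ('a, 'b) weyl \<Rightarrow> ('a, 'b) weyl" is "(+)" .
lift_definition uminus_weyl :: "('a, 'b) weyl \<Rightarrow> ('a, 'b) weyl" is uminus .
lift_definition minus_weyl :: "('a, 'b) weyl \<Rightarrow> ('a, 'b) weyl \<Rightarrow> ('a, 'b) weyl" is "(-)" .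
lift_definition times_weyl :: "('a, 'b) weyl \<Rightarrow> ('a, 'b) weyl \<Rightarrow> ('a, 'b) weyl" is nf_mult .

instance
proof
  fix a b c :: "('a, 'b) weyl"
  show "a * b * c = a * (b * c)"
    by transfer (use nf.act_mult in \<open>simp add: nf_mult_def\<close>)
  show "1 * a = a"
    by transfer (simp add: nf_mult_def nf_act_def nf_scale_eq dpow_zero)
  show "a * 1 = a" by transfer (rule nf_mult_one)
  show "(a + b) * c = a * c + b * c"
    by transfer (use nf.act_add_left in \<open>simp add: nf_mult_def\<close>)
  show "a * (b + c) = a * b + a * c"
    by transfer (use nf.act_add in \<open>simp add: nf_mult_def\<close>)
  show "(0 :: ('a, 'b) weyl) \<noteq> 1" by transfer (metis lookup_single_eq lookup_zero zero_neq_one)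
qed (transfer; simp)+

end

definition weyl_of :: "('n, 'k) mpoly \<Rightarrow> ('n, 'k::comm_ring_1) weyl" where
  "weyl_of a = Weyl (single 0 a)"

definition weyl_d :: "'n \<Rightarrow> ('n, 'k::comm_ring_1) weyl" where
  "weyl_d i = Weyl (single (single i 1) 1)"

lemma nf_act_single0: "sm 0 v = 0 \<Longrightarrow> nf_act sm d (single 0 a) v = sm a v"
  by (cases "a = 0") (simp_all add: nf_act_def dpow_zero)

lemma weyl_of_add: "weyl_of (a + b) = weyl_of a + weyl_of b"
  by (simp add: weyl_of_def plus_weyl.abs_eq eq_onp_def single_add)

lemma weyl_of_one: "weyl_of 1 = 1"
  by (simp add: weyl_of_def one_weyl_def)

lemma weyl_of_mult: "weyl_of (a * b) = weyl_of a * weyl_of b"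
  by (simp add: weyl_of_def times_weyl.abs_eq eq_onp_def nf_mult_def nf_act_single0 nf_scale_eq mult_single)

lemma nf_mult_d: "nf_mult (single (single i 1) 1) Q = nf_d i Q"
  using nf.act_d[of Q i "single 0 1"] nf_mult_one[of "nf_d i Q"] nf_mult_one[of Q]
    nf.dpow_step[of Q 0 i]
  by (simp add: nf_mult_def nf_act_def nf_scale_eq dpow_zero)

lemma weyl_d_weyl_of: "weyl_d i * weyl_of a = weyl_of a * weyl_d i + weyl_of (mderiv i a)"
proof -
  have "nf_mult (single 0 a) (single (single i 1) 1) = single (single i 1) a"
    by (simp add: nf_mult_def nf_act_single0 nf_scale_eq mult_single)
  then show ?thesis
    unfolding weyl_d_def weyl_of_def
    by (simp add: times_weyl.abs_eq plus_weyl.abs_eq eq_onp_def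
      nf_mult_d[unfolded One_nat_def] nf_d_single add.commute)
qed

lemma weyl_d_commute: "weyl_d i * weyl_d j = weyl_d j * weyl_d i"
  unfolding weyl_d_def
  by (simp add: times_weyl.abs_eq eq_onp_def nf_mult_d[unfolded One_nat_def] nf_d_single add.commute)


text \<open>
  The ring \<open>D\<^sub>X[s]\<close> with \<open>s\<close> central: \<open>\<Sum>\<^sub>j P\<^sub>j s\<^sup>j\<close> is stored as the map \<open>j \<mapsto> P\<^sub>j\<close>, and the product of
  \<^typ>\<open>nat \<Rightarrow>\<^sub>0 'r\<close> is the convolution product.
\<close>

type_synonym ('n, 'k) weyl_s = "nat \<Rightarrow>\<^sub>0 ('n, 'k) weyl"

definition weyl_s_of_poly :: "'k poly \<Rightarrow> ('n::{finite,linorder}, 'k::comm_ring_1) weyl_s" where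
  "weyl_s_of_poly b = (\<Sum>j\<le>degree b. single j (weyl_of (mconst (coeff b j))))"

locale left_module =
  fixes act :: "'r::ring_1 \<Rightarrow> 'm::ab_group_add \<Rightarrow> 'm"
  assumes act_add: "act p (v + w) = act p v + act p w"
    and act_add_left: "act (p + q) v = act p v + act q v"
    and act_mult: "act (p * q) v = act p (act q v)"
    and act_one: "act 1 v = v"

definition cyclic :: "('r \<Rightarrow> 'm \<Rightarrow> 'm) \<Rightarrow> 'm \<Rightarrow> 'm set" where
  "cyclic act x = {act p x | p. True}"

definition nfs_act ::
  "(('n, 'k) mpoly \<Rightarrow> 'v \<Rightarrow> 'v) \<Rightarrow> ('n \<Rightarrow> 'v \<Rightarrow> 'v) \<Rightarrow> ('v \<Rightarrow> 'v) \<Rightarrow>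
   ('n::{finite,linorder}, 'k::comm_ring_1) weyl_s \<Rightarrow> 'v \<Rightarrow> 'v::ab_group_add" where
  "nfs_act sm d s Q v = (\<Sum>j\<in>keys Q. (s ^^ j) (nf_act sm d (weyl_nf (lookup Q j)) v))"

context weyl_rep
begin

lemma weyl_act_one: "x \<in> C \<Longrightarrow> act (weyl_nf 1) x \<sim> sm 1 x"
  using act_single[of x 0 1] by (simp add: one_weyl.rep_eq)

lemma weyl_act_mult: "x \<in> C \<Longrightarrow> act (weyl_nf (P * Q)) x \<sim> act (weyl_nf P) (act (weyl_nf Q) x)"
  using act_mult by (simp add: times_weyl.rep_eq)

lemma weyl_act_add_left: "x \<in> C \<Longrightarrow> act (weyl_nf (P + Q)) x \<sim> act (weyl_nf P) x + act (weyl_nf Q) x"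
  using act_add_left by (simp add: plus_weyl.rep_eq)

end

locale weyl_rep_s = weyl_rep +
  fixes s :: "'a \<Rightarrow> 'a"
  assumes s_add: "s (x + y) = s x + s y"
    and s_N: "x \<in> N \<Longrightarrow> s x \<in> N" and s_C: "x \<in> C \<Longrightarrow> s x \<in> C"
    and s_sm: "x \<in> C \<Longrightarrow> s (sm a x) - sm a (s x) \<in> N"
    and s_d: "x \<in> C \<Longrightarrow> s (d i x) - d i (s x) \<in> N"
begin

lemma s_zero [simp]: "s 0 = 0" using s_add[of 0 0] by simp
lemma s_diff: "s (x - y) = s x - s y" by (metis s_add add_diff_cancel diff_add_cancel)
lemma s_sum: "s (sum f I) = (\<Sum>i\<in>I. s (f i))"
  by (induction I rule: infinite_finite_induct) (auto simp: s_add)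
lemma s_eqv: "x \<sim> y \<Longrightarrow> s x \<sim> s y" unfolding eqv_def using s_N by (simp flip: s_diff)

lemma s_dpow:
  assumes "x \<in> C"
  shows "s (dpow d \<beta> x) \<sim> dpow d \<beta> (s x)"
proof -
  have 1: "s ((d i ^^ k) y) \<sim> (d i ^^ k) (s y)" if "y \<in> C" for i k y
  proof (induction k)
    case (Suc k)
    have "s (d i ((d i ^^ k) y)) \<sim> d i (s ((d i ^^ k) y))" using s_d dp_C that by (simp add: eqv_def)
    also have "\<dots> \<sim> d i ((d i ^^ k) (s y))" using Suc by (rule d_eqv)
    finally show ?case by simp
  qed simp
  have "s (dpl xs \<beta> x) \<sim> dpl xs \<beta> (s x)" for xs
  proof (induction xs)
    case (Cons i xs)
    have "s ((d i ^^ lookup \<beta> i) (dpl xs \<beta> x)) \<sim> (d i ^^ lookup \<beta> i) (s (dpl xs \<beta> x))"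
      using 1 dpl_C assms by blast
    also have "\<dots> \<sim> (d i ^^ lookup \<beta> i) (dpl xs \<beta> (s x))" using Cons by (rule dp_eqv)
    finally show ?case by simp
  qed simp
  then show ?thesis by (simp add: dpow_dpl)
qed

lemma s_act:
  assumes "x \<in> C"
  shows "s (act P x) \<sim> act P (s x)"
proof -
  have "s (sm a (dpow d \<beta> x)) \<sim> sm a (dpow d \<beta> (s x))" for a \<beta>
  proof -
    have "s (sm a (dpow d \<beta> x)) \<sim> sm a (s (dpow d \<beta> x))" using s_sm dpow_C assms by (simp add: eqv_def)
    also have "\<dots> \<sim> sm a (dpow d \<beta> (s x))" using s_dpow[OF assms] by (rule sm_eqv)
    finally show ?thesis .
  qed
  then show ?thesis unfolding nf_act_def s_sum by (intro eqv_sum)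
qed

lemma sp_C: "x \<in> C \<Longrightarrow> (s ^^ k) x \<in> C" by (induction k) (auto intro: s_C)
lemma sp_N: "x \<in> N \<Longrightarrow> (s ^^ k) x \<in> N" by (induction k) (auto intro: s_N)
lemma sp_add: "(s ^^ k) (x + y) = (s ^^ k) x + (s ^^ k) y" by (induction k) (auto simp: s_add)
lemma sp_zero [simp]: "(s ^^ k) 0 = 0" by (induction k) auto
lemma sp_eqv: "x \<sim> y \<Longrightarrow> (s ^^ k) x \<sim> (s ^^ k) y" by (induction k) (auto intro: s_eqv)
lemma sp_act: "x \<in> C \<Longrightarrow> (s ^^ k) (act P x) \<sim> act P ((s ^^ k) x)"
proof (induction k)
  case (Suc k)
  have "s ((s ^^ k) (act P x)) \<sim> s (act P ((s ^^ k) x))" using Suc by (intro s_eqv)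
  also have "\<dots> \<sim> act P (s ((s ^^ k) x))" using s_act sp_C Suc.prems by blast
  finally show ?case by simp
qed simp

abbreviation acts where "acts \<equiv> nfs_act sm d s"

lemma acts_C: "x \<in> C \<Longrightarrow> acts P x \<in> C" unfolding nfs_act_def by (intro C_sum sp_C act_C)
lemma acts_N: "x \<in> N \<Longrightarrow> acts P x \<in> N" unfolding nfs_act_def by (intro N_sum sp_N act_N)
lemma acts_add: "acts P (x + y) = acts P x + acts P y"
  unfolding nfs_act_def by (simp add: act_add sp_add sum.distrib)
lemma acts_diff: "acts P (x - y) = acts P x - acts P y" by (metis acts_add add_diff_cancel diff_add_cancel)
lemma acts_eqv: "x \<sim> y \<Longrightarrow> acts P x \<sim> acts P y" unfolding eqv_def using acts_N by (simp flip: acts_diff)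

lemma acts_zero: "acts P 0 = 0" using acts_diff[of P 0 0] by simp
lemma acts_zero_left: "acts 0 x = 0" by (simp add: nfs_act_def)

lemma acts_single: "acts (single j p) x = (s ^^ j) (act (weyl_nf p) x)"
  by (cases "p = 0") (simp_all add: nfs_act_def zero_weyl.rep_eq act_zero)

lemma acts_add_left:
  assumes "x \<in> C"
  shows "acts (P + Q) x \<sim> acts P x + acts Q x"
proof -
  let ?A = "keys P \<union> keys Q"
  have sup: "acts R x = (\<Sum>j\<in>?A. (s ^^ j) (act (weyl_nf (lookup R j)) x))" if "keys R \<subseteq> ?A" for R
    unfolding nfs_act_def
    by (rule sum.mono_neutral_left) (use that in \<open>auto simp: in_keys_iff zero_weyl.rep_eq act_zero\<close>)
  have "acts (P + Q) x \<sim> (\<Sum>j\<in>?A. (s ^^ j) (act (weyl_nf (lookup P j)) x) + (s ^^ j) (act (weyl_nf (lookup Q j)) x))"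
    unfolding sup[OF Poly_Mapping.keys_add] lookup_add sp_add[symmetric]
    using weyl_act_add_left[OF assms] by (intro eqv_sum sp_eqv)
  also have "\<dots> = acts P x + acts Q x" by (simp add: sum.distrib sup)
  finally show ?thesis .
qed

lemma acts_mult:
  assumes "x \<in> C"
  shows "acts (P * Q) x \<sim> acts P (acts Q x)"
proof (induction P rule: pm_induct)
  case (single j p)
  show ?case
  proof (induction Q rule: pm_induct)
    case (single k q)
    have "acts (single j p * single k q) x = (s ^^ j) ((s ^^ k) (act (weyl_nf (p * q)) x))"
      by (simp add: mult_single acts_single funpow_add)
    also have "\<dots> \<sim> (s ^^ j) ((s ^^ k) (act (weyl_nf p) (act (weyl_nf q) x)))"
      by (intro sp_eqv weyl_act_mult assms)
    also have "\<dots> \<sim> (s ^^ j) (act (weyl_nf p) ((s ^^ k) (act (weyl_nf q) x)))"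
      by (intro sp_eqv sp_act act_C assms)
    finally show ?case by (simp add: acts_single)
  next
    case (add Q R)
    have "acts (single j p * (Q + R)) x \<sim> acts (single j p * Q) x + acts (single j p * R) x"
      unfolding distrib_left by (rule acts_add_left) fact
    also have "\<dots> \<sim> acts (single j p) (acts Q x) + acts (single j p) (acts R x)"
      using add by (rule eqv_add)
    also have "\<dots> = acts (single j p) (acts Q x + acts R x)" by (simp add: acts_add)
    also have "\<dots> \<sim> acts (single j p) (acts (Q + R) x)"
      by (intro acts_eqv eqv_sym[OF acts_add_left] assms)
    finally show ?case .
  qed (simp add: acts_zero_left acts_zero)
next
  case (add P R)
  have "acts ((P + R) * Q) x \<sim> acts (P * Q) x + acts (R * Q) x"
    unfolding distrib_right by (rule acts_add_left) fact
  also have "\<dots> \<sim> acts P (acts Q x) + acts R (acts Q x)"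
    using add by (rule eqv_add)
  also have "\<dots> \<sim> acts (P + R) (acts Q x)"
    by (intro eqv_sym[OF acts_add_left] acts_C assms)
  finally show ?case .
qed (simp add: nfs_act_def)

end


section \<open>Tensor products over the polynomial ring\<close>

text \<open>
  The second factor lives on a subgroup \<open>B\<close> of its type.  The tensor product is the quotient of the
  free abelian group on \<open>UNIV \<times> B\<close> by the subgroup \<open>tens_rel\<close>; its elements are cosets.
\<close>

inductive_set tens_rel ::
  "('r \<Rightarrow> 'm::ab_group_add \<Rightarrow> 'm) \<Rightarrow> ('r \<Rightarrow> 'l::ab_group_add \<Rightarrow> 'l) \<Rightarrow> 'l set \<Rightarrow> (('m \<times> 'l) \<Rightarrow>\<^sub>0 int) set"
  for sM sL B where
  zero: "0 \<in> tens_rel sM sL B"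
| diff: "x \<in> tens_rel sM sL B \<Longrightarrow> y \<in> tens_rel sM sL B \<Longrightarrow> x - y \<in> tens_rel sM sL B"
| add_left: "w \<in> B \<Longrightarrow> frag_of (v + v', w) - (frag_of (v, w) + frag_of (v', w)) \<in> tens_rel sM sL B"
| add_right: "w \<in> B \<Longrightarrow> w' \<in> B \<Longrightarrow>
    frag_of (v, w + w') - (frag_of (v, w) + frag_of (v, w')) \<in> tens_rel sM sL B"
| balanced: "w \<in> B \<Longrightarrow> frag_of (sM a v, w) - frag_of (v, sL a w) \<in> tens_rel sM sL B"

definition tens_free :: "'l set \<Rightarrow> (('m \<times> 'l) \<Rightarrow>\<^sub>0 int) set" where
  "tens_free B = {t. keys t \<subseteq> UNIV \<times> B}"

definition tens_class where
  "tens_class sM sL B t = {t'. t' - t \<in> tens_rel sM sL B}"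

definition tens_space where
  "tens_space sM sL B = tens_class sM sL B ` tens_free B"

definition tens_op where
  "tens_op sM sL B \<phi> X = (\<Union>t\<in>X. tens_class sM sL B (\<phi> t))"

text \<open>
  Scalars, derivations (by the Leibniz rule) and \<open>s\<close> on \<open>v \<otimes> w\<close>, extended additively.
\<close>

definition tens_sm :: "('r \<Rightarrow> 'l \<Rightarrow> 'l) \<Rightarrow> 'r \<Rightarrow> (('m \<times> 'l) \<Rightarrow>\<^sub>0 int) \<Rightarrow> (('m \<times> 'l) \<Rightarrow>\<^sub>0 int)" where
  "tens_sm sL a = frag_extend (\<lambda>(v, w). frag_of (v, sL a w))"

definition tens_d ::
  "('n \<Rightarrow> 'm \<Rightarrow> 'm) \<Rightarrow> ('n \<Rightarrow> 'l \<Rightarrow> 'l) \<Rightarrow> 'n \<Rightarrow> (('m \<times> 'l) \<Rightarrow>\<^sub>0 int) \<Rightarrow> (('m \<times> 'l) \<Rightarrow>\<^sub>0 int)" where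
  "tens_d dM dL i = frag_extend (\<lambda>(v, w). frag_of (dM i v, w) + frag_of (v, dL i w))"

definition tens_s :: "('l \<Rightarrow> 'l) \<Rightarrow> (('m \<times> 'l) \<Rightarrow>\<^sub>0 int) \<Rightarrow> (('m \<times> 'l) \<Rightarrow>\<^sub>0 int)" where
  "tens_s sS = frag_extend (\<lambda>(v, w). frag_of (v, sS w))"

locale tens =
  fixes sM :: "('n::{finite,linorder}, 'k::comm_ring_1) mpoly \<Rightarrow> 'm::ab_group_add \<Rightarrow> 'm"
    and dM :: "'n \<Rightarrow> 'm \<Rightarrow> 'm"
    and sL :: "('n, 'k) mpoly \<Rightarrow> 'l::ab_group_add \<Rightarrow> 'l"
    and dL :: "'n \<Rightarrow> 'l \<Rightarrow> 'l"
    and B :: "'l set"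
  assumes sM_add: "sM a (v + v') = sM a v + sM a v'"
    and dM_add: "dM i (v + v') = dM i v + dM i v'"
    and dM_sM: "dM i (sM a v) = sM (mderiv i a) v + sM a (dM i v)"
    and dM_comm: "dM i (dM j v) = dM j (dM i v)"
    and sL_B: "w \<in> B \<Longrightarrow> sL a w \<in> B"
    and dL_B: "w \<in> B \<Longrightarrow> dL i w \<in> B"
    and sL_add: "sL a (w + w') = sL a w + sL a w'"
    and dL_add: "dL i (w + w') = dL i w + dL i w'"
    and sL_add_left: "sL (a + b) w = sL a w + sL b w"
    and sL_mult: "sL (a * b) w = sL a (sL b w)"
    and dL_sL: "dL i (sL a w) = sL (mderiv i a) w + sL a (dL i w)"
    and dL_comm: "dL i (dL j w) = dL j (dL i w)"
begin

abbreviation "N \<equiv> tens_rel sM sL B"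
abbreviation "F \<equiv> tens_free B :: (('m \<times> 'l) \<Rightarrow>\<^sub>0 int) set"

lemma N_add: "x \<in> N \<Longrightarrow> y \<in> N \<Longrightarrow> x + y \<in> N"
  using tens_rel.diff[of x sM sL B "0 - y"] tens_rel.diff[of 0 sM sL B y] tens_rel.zero by fastforce

lemma F_induct [consumes 1, case_names zero one diff]:
  assumes "x \<in> F" "P 0" "\<And>v w. w \<in> B \<Longrightarrow> P (frag_of (v, w))" "\<And>x y. P x \<Longrightarrow> P y \<Longrightarrow> P (x - y)"
  shows "P x"
  by (rule frag_induction[of x "UNIV \<times> B"]) (use assms in \<open>auto simp: tens_free_def\<close>)

lemma F_diff: "x \<in> F \<Longrightarrow> y \<in> F \<Longrightarrow> x - y \<in> F"
  using keys_diff[of x y] by (auto simp: tens_free_def)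

lemma F_add: "x \<in> F \<Longrightarrow> y \<in> F \<Longrightarrow> x + y \<in> F"
  using Poly_Mapping.keys_add[of x y] by (auto simp: tens_free_def)

lemma F_of: "w \<in> B \<Longrightarrow> frag_of (v, w) \<in> F" by (simp add: tens_free_def)

lemma frag_extend_F:
  assumes "\<And>v w. w \<in> B \<Longrightarrow> g (v, w) \<in> F" "x \<in> F"
  shows "frag_extend g x \<in> F"
  using assms(2)
proof (induction rule: F_induct)
  case zero show ?case by (simp add: tens_free_def)
qed (auto simp: assms F_diff frag_extend_diff)

lemma frag_extend_N:
  assumes "\<And>v v' w. w \<in> B \<Longrightarrow> g (v + v', w) - (g (v, w) + g (v', w)) \<in> N"
    and "\<And>v w w'. w \<in> B \<Longrightarrow> w' \<in> B \<Longrightarrow> g (v, w + w') - (g (v, w) + g (v, w')) \<in> N"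
    and "\<And>a v w. w \<in> B \<Longrightarrow> g (sM a v, w) - g (v, sL a w) \<in> N"
    and "x \<in> N"
  shows "frag_extend g x \<in> N"
  using assms(4)
  by (induction rule: tens_rel.induct)
    (auto simp: frag_extend_diff frag_extend_add assms(1-3) tens_rel.zero intro: tens_rel.diff)

lemma frag_extend_rel:
  assumes "\<And>v w. w \<in> B \<Longrightarrow> g (frag_of (v, w)) \<in> N" "\<And>x y. g (x - y) = g x - g y" "x \<in> F"
  shows "g x \<in> N"
  using assms(3)
proof (induction rule: F_induct)
  case zero show ?case using assms(2)[of 0 0] by (simp add: tens_rel.zero)
qed (auto simp: assms intro: tens_rel.diff)

sublocale rep: weyl_rep N F "tens_sm sL" "tens_d dM dL"
proof
  fix a b :: "('n, 'k) mpoly" and x y :: "('m \<times> 'l) \<Rightarrow>\<^sub>0 int" and i j :: 'n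
  show "0 \<in> N" by (rule tens_rel.zero)
  show "x - y \<in> N" if "x \<in> N" "y \<in> N" using that by (rule tens_rel.diff)
  show "0 \<in> F" by (simp add: tens_free_def)
  show "x - y \<in> F" if "x \<in> F" "y \<in> F" using that by (rule F_diff)
  show "tens_sm sL a (x + y) = tens_sm sL a x + tens_sm sL a y"
    by (simp add: tens_sm_def frag_extend_add)
  show "tens_d dM dL i (x + y) = tens_d dM dL i x + tens_d dM dL i y"
    by (simp add: tens_d_def frag_extend_add)
  show "tens_sm sL a x \<in> N" if "x \<in> N"
    unfolding tens_sm_def
  proof (rule frag_extend_N[OF _ _ _ that])
    fix b v w assume "w \<in> B"
    then show "(case (sM b v, w) of (v, w) \<Rightarrow> frag_of (v, sL a w))
        - (case (v, sL b w) of (v, w) \<Rightarrow> frag_of (v, sL a w)) \<in> N"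
      using tens_rel.balanced[where w = "sL a w" and a = b and v = v and sM = sM and sL = sL and B = B] sL_B
      by (simp flip: sL_mult add: mult.commute)
  qed (auto simp: sL_add intro: tens_rel.intros sL_B)
  show "tens_d dM dL i x \<in> N" if "x \<in> N"
    unfolding tens_d_def
  proof (rule frag_extend_N[OF _ _ _ that], goal_cases)
    case (1 v v' w)
    show ?case
      using N_add[OF tens_rel.add_left[of w B "dM i v" "dM i v'" sM sL]
          tens_rel.add_left[OF dL_B[of w i], of v v' sM sL]] 1
      by (simp add: dM_add algebra_simps)
  next
    case (2 v w w')
    show ?case
      using N_add[OF tens_rel.add_right[of w B w' "dM i v" sM sL]
          tens_rel.add_right[OF dL_B[of w i] dL_B[of w' i], of v sM sL]] 2
      by (simp add: dL_add algebra_simps)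
  next
    case (3 b v w)
    let ?r1 = "frag_of (sM (mderiv i b) v + sM b (dM i v), w) - (frag_of (sM (mderiv i b) v, w) + frag_of (sM b (dM i v), w))"
    let ?r2 = "frag_of (v, sL (mderiv i b) w + sL b (dL i w)) - (frag_of (v, sL (mderiv i b) w) + frag_of (v, sL b (dL i w)))"
    let ?r3 = "frag_of (sM (mderiv i b) v, w) - frag_of (v, sL (mderiv i b) w)"
    let ?r4 = "frag_of (sM b (dM i v), w) - frag_of (dM i v, sL b w)"
    let ?r5 = "frag_of (sM b v, dL i w) - frag_of (v, sL b (dL i w))"
    have "?r1 + ?r3 + ?r4 + ?r5 - ?r2 \<in> N"
      by (intro N_add tens_rel.diff[of _ _ _ _ ?r2] tens_rel.add_left tens_rel.add_right tens_rel.balanced 3 dL_B sL_B)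
    then show ?case by (simp add: dM_sM dL_sL algebra_simps)
  qed
  show "tens_sm sL a x \<in> F" if "x \<in> F"
    unfolding tens_sm_def by (rule frag_extend_F[OF _ that]) (auto intro: F_of sL_B)
  show "tens_d dM dL i x \<in> F" if "x \<in> F"
    unfolding tens_d_def by (rule frag_extend_F[OF _ that]) (auto intro: F_of F_add dL_B)
  show "tens_sm sL (a + b) x - (tens_sm sL a x + tens_sm sL b x) \<in> N" if "x \<in> F"
    by (rule frag_extend_rel[OF _ _ that])
      (auto simp: tens_sm_def frag_extend_diff sL_add_left algebra_simps diff_diff_eq
        intro: tens_rel.add_right[unfolded diff_diff_eq[symmetric]] tens_rel.add_right sL_B)
  show "tens_sm sL (a * b) x - tens_sm sL a (tens_sm sL b x) \<in> N" if "x \<in> F"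
    by (rule frag_extend_rel[OF _ _ that])
      (auto simp: tens_sm_def frag_extend_diff sL_mult tens_rel.zero)
  show "tens_d dM dL i (tens_sm sL a x)
      - (tens_sm sL (mderiv i a) x + tens_sm sL a (tens_d dM dL i x)) \<in> N" if "x \<in> F"
  proof (rule frag_extend_rel[OF _ _ that], goal_cases)
    case (1 v w)
    then show ?case
      using tens_rel.add_right[OF sL_B[of w "mderiv i a"] sL_B[OF dL_B[of w i], of a], of v sM sL]
      by (simp add: tens_sm_def tens_d_def frag_extend_add dL_sL algebra_simps)
  qed (simp add: tens_sm_def tens_d_def frag_extend_diff)
  show "tens_d dM dL i (tens_d dM dL j x) - tens_d dM dL j (tens_d dM dL i x) \<in> N" if "x \<in> F"
    by (rule frag_extend_rel[OF _ _ that])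
      (auto simp: tens_d_def frag_extend_diff frag_extend_add dM_comm[of i j] dL_comm[of i j]
        tens_rel.zero algebra_simps)
qed

lemma class_eq: "tens_class sM sL B t = tens_class sM sL B t' \<longleftrightarrow> t - t' \<in> N"
proof
  assume "tens_class sM sL B t = tens_class sM sL B t'"
  moreover have "t \<in> tens_class sM sL B t" by (simp add: tens_class_def tens_rel.zero)
  ultimately show "t - t' \<in> N" by (simp add: tens_class_def)
next
  assume *: "t - t' \<in> N"
  show "tens_class sM sL B t = tens_class sM sL B t'"
    using N_add[OF _ *] tens_rel.diff[OF _ *] by (fastforce simp: tens_class_def)
qed

lemma op_class:
  assumes "\<And>x y. \<phi> (x - y) = \<phi> x - \<phi> y" "\<And>x. x \<in> N \<Longrightarrow> \<phi> x \<in> N"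
  shows "tens_op sM sL B \<phi> (tens_class sM sL B t) = tens_class sM sL B (\<phi> t)"
proof -
  have "tens_class sM sL B (\<phi> t') = tens_class sM sL B (\<phi> t)" if "t' \<in> tens_class sM sL B t" for t'
    using that assms(2)[of "t' - t"] by (simp add: class_eq assms(1)) (simp add: tens_class_def)
  moreover have "t \<in> tens_class sM sL B t" by (simp add: tens_class_def tens_rel.zero)
  ultimately show ?thesis unfolding tens_op_def by blast
qed

end


section \<open>The modules \<open>K[x,f\<^sup>-\<^sup>1,s]f\<^sup>s\<close> and \<open>K[x,f\<^sup>-\<^sup>1]f\<^sup>\<lambda>\<close>\<close>

type_synonym ('n, 'k) mfract = "('n, 'k) mpoly fract"

definition mfract_of :: "('n::linorder, 'k::idom) mpoly \<Rightarrow> ('n, 'k) mfract" where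
  "mfract_of a = Fract a 1"

text \<open>Quotient rule\<close>

definition fderiv :: "'n::linorder \<Rightarrow> ('n, 'k::idom) mfract \<Rightarrow> ('n, 'k) mfract" where
  "fderiv i q = (THE r. \<exists>a b. b \<noteq> 0 \<and> q = Fract a b \<and> r = Fract (mderiv i a * b - a * mderiv i b) (b * b))"

lemma fderiv_Fract:
  fixes a b :: "('n::linorder, 'k::idom) mpoly"
  assumes b: "b \<noteq> 0"
  shows "fderiv i (Fract a b) = Fract (mderiv i a * b - a * mderiv i b) (b * b)"
  unfolding fderiv_def
proof (rule the_equality)
  fix r assume "\<exists>c d. d \<noteq> 0 \<and> Fract a b = Fract c d \<and> r = Fract (mderiv i c * d - c * mderiv i d) (d * d)"
  then obtain c d where d: "d \<noteq> 0" and cd: "Fract a b = Fract c d"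
    and r: "r = Fract (mderiv i c * d - c * mderiv i d) (d * d)" by blast
  have e: "a * d = c * b" using cd b d by (simp add: eq_fract)
  have "mderiv i (a * d) = mderiv i (c * b)" by (simp add: e)
  then have e': "mderiv i a * d + a * mderiv i d = mderiv i c * b + c * mderiv i b"
    by (simp add: mderiv_mult)
  have "(mderiv i a * b - a * mderiv i b) * (d * d)
      = (mderiv i a * d + a * mderiv i d) * (b * d) - (a * d) * (b * mderiv i d + mderiv i b * d)"
    by (simp add: algebra_simps)
  also have "\<dots> = (mderiv i c * d - c * mderiv i d) * (b * b)"
    unfolding e' e by (simp add: algebra_simps)
  finally show "r = Fract (mderiv i a * b - a * mderiv i b) (b * b)"
    unfolding r using b d by (simp add: eq_fract)
qed (use b in blast)

lemma fderiv_of: "fderiv i (mfract_of a) = mfract_of (mderiv i a)"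
  by (simp add: mfract_of_def fderiv_Fract)

lemma fderiv_add: "fderiv i (p + q) = fderiv i p + fderiv i q"
  by (cases p; cases q) (simp add: fderiv_Fract eq_fract mderiv_add mderiv_mult algebra_simps)

lemma fderiv_mult: "fderiv i (p * q) = fderiv i p * q + p * fderiv i q"
  by (cases p; cases q) (simp add: fderiv_Fract eq_fract mderiv_add mderiv_mult algebra_simps)

lemma fderiv_zero [simp]: "fderiv i 0 = 0"
  by (metis fderiv_add add_cancel_right_right add.right_neutral)

lemma mfract_of_add: "mfract_of (a + b) = mfract_of a + mfract_of b"
  and mfract_of_mult: "mfract_of (a * b) = mfract_of a * mfract_of b"
  and mfract_of_zero [simp]: "mfract_of 0 = 0"
  and mfract_of_one [simp]: "mfract_of 1 = 1"
  and mfract_of_minus: "mfract_of (- a) = - mfract_of a"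
  and mfract_of_diff: "mfract_of (a - b) = mfract_of a - mfract_of b"
  and mfract_of_eq: "mfract_of a = mfract_of b \<longleftrightarrow> a = b"
  by (simp_all add: mfract_of_def Zero_fract_def One_fract_def eq_fract)

lemma mfract_of_power: "mfract_of (a ^ k) = mfract_of a ^ k"
  by (induction k) (simp_all add: mfract_of_mult)

lemma mfract_of_nat: "mfract_of (of_nat k) = of_nat k"
  by (induction k) (simp_all add: mfract_of_add)

lemma mfract_ofE: obtains a b where "b \<noteq> 0" "q = mfract_of a / mfract_of b"
  by (cases q) (auto simp: mfract_of_def)

lemma fderiv_commute: "fderiv i (fderiv j q) = fderiv j (fderiv i q)"
proof -
  obtain a b where b: "b \<noteq> 0" and q: "q = mfract_of a / mfract_of b" by (rule mfract_ofE)
  have b': "mfract_of b \<noteq> 0" using b mfract_of_eq[of b 0] by simp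
  have "q * mfract_of b = mfract_of a" using q b' by simp
  then have "fderiv i (fderiv j (q * mfract_of b)) = fderiv j (fderiv i (q * mfract_of b))"
    by (simp add: fderiv_of mderiv_commute[of i j])
  then have "fderiv i (fderiv j q) * mfract_of b = fderiv j (fderiv i q) * mfract_of b"
    by (simp add: fderiv_mult fderiv_add fderiv_of mderiv_commute[of i j] algebra_simps)
  then show ?thesis using b' by simp
qed

lemma fderiv_power: "fderiv i (q ^ k) = of_nat k * q ^ (k - 1) * fderiv i q"
proof (induction k)
  case 0
  then show ?case using fderiv_of[of i 1] by simp
next
  case (Suc k)
  then show ?case by (cases k) (simp_all add: fderiv_mult algebra_simps)
qed

lemma fderiv_div_power:
  assumes "f \<noteq> 0"
  shows "fderiv i (q / f ^ k) = fderiv i q / f ^ k - of_nat k * fderiv i f * q / f ^ (k + 1)"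
proof -
  have "fderiv i q = fderiv i (q / f ^ k * f ^ k)" using assms by simp
  also have "\<dots> = fderiv i (q / f ^ k) * f ^ k + q / f ^ k * (of_nat k * f ^ (k - 1) * fderiv i f)"
    unfolding fderiv_mult fderiv_power ..
  finally have h: "fderiv i (q / f ^ k) = (fderiv i q - q / f ^ k * (of_nat k * f ^ (k - 1) * fderiv i f)) / f ^ k"
    using assms by (simp add: field_simps)
  show ?thesis unfolding h using assms by (cases k) (simp_all add: field_simps)
qed

definition loc_ring :: "('n::linorder, 'k::idom) mpoly \<Rightarrow> ('n, 'k) mfract set" where
  "loc_ring f = {mfract_of a / mfract_of f ^ k | a k. True}"

text \<open>
  Both modules are free of rank one, so \<open>g f\<^sup>s\<close> and \<open>g f\<^sup>\<lambda>\<close> are represented by their coefficient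
  \<open>g\<close>, and the generators \<open>f\<^sup>s\<close>, \<open>f\<^sup>\<lambda>\<close> by \<open>1\<close>.  Elements of \<open>K[x,f\<^sup>-\<^sup>1,s]\<close> are univariate polynomials
  in \<open>s\<close> over \<open>K(x)\<close> with coefficients in \<open>K[x,f\<^sup>-\<^sup>1]\<close>.
\<close>

definition fs_carrier :: "('n::linorder, 'k::idom) mpoly \<Rightarrow> ('n, 'k) mfract poly set" where
  "fs_carrier f = {g. \<forall>j. coeff g j \<in> loc_ring f}"

definition fs_scale :: "('n::linorder, 'k::idom) mpoly \<Rightarrow> ('n, 'k) mfract poly \<Rightarrow> ('n, 'k) mfract poly" where
  "fs_scale a g = smult (mfract_of a) g"

definition fs_d ::
  "('n::linorder, 'k::idom) mpoly \<Rightarrow> 'n \<Rightarrow> ('n, 'k) mfract poly \<Rightarrow> ('n, 'k) mfract poly" where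
  "fs_d f i g = map_poly (fderiv i) g + smult (mfract_of (mderiv i f) / mfract_of f) ([:0, 1:] * g)"

definition fs_s :: "('n::linorder, 'k::idom) mfract poly \<Rightarrow> ('n, 'k) mfract poly" where
  "fs_s g = [:0, 1:] * g"

text \<open>\<open>f\<^sup>s\<^sup>+\<^sup>k = f\<^sup>k f\<^sup>s\<close>\<close>

definition fs_pow :: "('n::linorder, 'k::idom) mpoly \<Rightarrow> int \<Rightarrow> ('n, 'k) mfract poly" where
  "fs_pow f k = [:mfract_of f powi k:]"

definition fl_scale :: "('n::linorder, 'k::idom) mpoly \<Rightarrow> ('n, 'k) mfract \<Rightarrow> ('n, 'k) mfract" where
  "fl_scale a g = mfract_of a * g"

definition fl_d ::
  "('n::linorder, 'k::idom) mpoly \<Rightarrow> 'k \<Rightarrow> 'n \<Rightarrow> ('n, 'k) mfract \<Rightarrow> ('n, 'k) mfract" where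
  "fl_d f lam i g = fderiv i g + mfract_of (mconst lam) * mfract_of (mderiv i f) / mfract_of f * g"

lemma fs_d_formula:
  fixes a :: "('n::linorder, 'k::idom) mpoly poly"
  assumes "f \<noteq> 0"
  shows "fs_d f i (smult (1 / mfract_of f ^ k) (map_poly mfract_of a))
    = smult (1 / mfract_of f ^ k) (map_poly mfract_of (map_poly (mderiv i) a))
      + smult (mfract_of (mderiv i f) / mfract_of f ^ (k + 1)) ([:- of_nat k, 1:] * map_poly mfract_of a)"
proof (rule poly_eqI)
  fix n
  have nz: "mfract_of f \<noteq> 0" using assms mfract_of_eq[of f 0] by simp
  have "fderiv i (mfract_of (coeff a n) / mfract_of f ^ k)
    = mfract_of (mderiv i (coeff a n)) / mfract_of f ^ k
      - of_nat k * mfract_of (mderiv i f) * mfract_of (coeff a n) / mfract_of f ^ (k + 1)"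
    using fderiv_div_power[OF nz, of i "mfract_of (coeff a n)" k] by (simp add: fderiv_of)
  then show "coeff (fs_d f i (smult (1 / mfract_of f ^ k) (map_poly mfract_of a))) n
    = coeff (smult (1 / mfract_of f ^ k) (map_poly mfract_of (map_poly (mderiv i) a))
      + smult (mfract_of (mderiv i f) / mfract_of f ^ (k + 1)) ([:- of_nat k, 1:] * map_poly mfract_of a)) n"
    using nz by (cases n) (simp_all add: fs_d_def coeff_map_poly field_simps)
qed

lemma fl_d_formula:
  assumes "f \<noteq> 0"
  shows "fl_d f lam i (mfract_of a / mfract_of f ^ k)
    = mfract_of (mderiv i a) / mfract_of f ^ k
      + mfract_of (mconst lam - of_nat k) * mfract_of (mderiv i f) * mfract_of a / mfract_of f ^ (k + 1)"
proof -
  have nz: "mfract_of f \<noteq> 0" using assms mfract_of_eq[of f 0] by simp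
  show ?thesis
    unfolding fl_d_def fderiv_div_power[OF nz] fderiv_of mfract_of_diff mfract_of_nat using nz by (simp add: field_simps)
qed

lemma loc_ring_0: "0 \<in> loc_ring f"
  unfolding loc_ring_def by (rule CollectI, rule exI[of _ 0]) simp

lemma loc_ring_of: "mfract_of a \<in> loc_ring f"
  unfolding loc_ring_def by (rule CollectI, rule exI[of _ a], rule exI[of _ 0]) simp

lemma loc_ring_mult: "p \<in> loc_ring f \<Longrightarrow> q \<in> loc_ring f \<Longrightarrow> p * q \<in> loc_ring f"
  unfolding loc_ring_def by (auto simp flip: mfract_of_mult power_add) blast

lemma loc_ring_divide:
  assumes "q \<in> loc_ring f"
  shows "mfract_of a * q / mfract_of f \<in> loc_ring f"
proof -
  have "mfract_of a / mfract_of f \<in> loc_ring f"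
    unfolding loc_ring_def by (rule CollectI, rule exI[of _ a], rule exI[of _ 1]) simp
  from loc_ring_mult[OF this assms] show ?thesis by simp
qed

lemma loc_ring_add:
  assumes "f \<noteq> 0" "p \<in> loc_ring f" "q \<in> loc_ring f"
  shows "p + q \<in> loc_ring f"
proof -
  have nz: "mfract_of f \<noteq> 0" using assms mfract_of_eq[of f 0] by simp
  obtain a k b l where "p = mfract_of a / mfract_of f ^ k" "q = mfract_of b / mfract_of f ^ l"
    using assms by (auto simp: loc_ring_def)
  then have "p + q = mfract_of (a * f ^ l + b * f ^ k) / mfract_of f ^ (k + l)"
    using nz by (simp add: mfract_of_add mfract_of_mult mfract_of_power power_add add_divide_distrib)
  then show ?thesis unfolding loc_ring_def by blast
qed

lemma loc_ring_fderiv: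
  assumes "f \<noteq> 0" "p \<in> loc_ring f"
  shows "fderiv i p \<in> loc_ring f"
proof -
  have nz: "mfract_of f \<noteq> 0" using assms mfract_of_eq[of f 0] by simp
  obtain a k where p: "p = mfract_of a / mfract_of f ^ k"
    using assms by (auto simp: loc_ring_def)
  have "fderiv i p = mfract_of (mderiv i a * f - of_nat k * mderiv i f * a) / mfract_of f ^ (k + 1)"
    unfolding p fderiv_div_power[OF nz] fderiv_of mfract_of_diff mfract_of_mult mfract_of_nat
    using nz by (simp add: field_simps)
  then show ?thesis unfolding loc_ring_def by blast
qed

lemma fs_d_carrier:
  assumes "f \<noteq> 0" "g \<in> fs_carrier f"
  shows "fs_d f i g \<in> fs_carrier f"
proof -
  have "coeff (fs_d f i g) n \<in> loc_ring f" for n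
    unfolding fs_d_def
    using assms by (cases n)
      (auto simp: coeff_map_poly fs_carrier_def intro!: loc_ring_add loc_ring_fderiv loc_ring_divide)
  then show ?thesis by (simp add: fs_carrier_def)
qed

lemma fderiv_log_symmetric:
  assumes "(f :: ('n::linorder, 'k::idom) mpoly) \<noteq> 0"
  shows "fderiv i (mfract_of (mderiv j f) / mfract_of f) = fderiv j (mfract_of (mderiv i f) / mfract_of f)"
  using fderiv_div_power[of "mfract_of f" i "mfract_of (mderiv j f)" 1]
    fderiv_div_power[of "mfract_of f" j "mfract_of (mderiv i f)" 1] mfract_of_eq[of f 0] assms
  by (simp add: fderiv_of mderiv_commute[of i j] mult.commute)

lemma fs_d_commute:
  assumes "f \<noteq> 0"
  shows "fs_d f i (fs_d f j g) = fs_d f j (fs_d f i g)"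
proof (rule poly_eqI)
  fix n
  show "coeff (fs_d f i (fs_d f j g)) n = coeff (fs_d f j (fs_d f i g)) n"
    using fderiv_log_symmetric[OF assms, of i j]
    by (cases n; cases "n - 1")
      (simp_all add: fs_d_def coeff_map_poly fderiv_add fderiv_mult fderiv_commute[of i j] algebra_simps
        del: times_divide_eq_left times_divide_eq_right)
qed

lemma fl_d_commute:
  assumes "f \<noteq> 0"
  shows "fl_d f lam i (fl_d f lam j g) = fl_d f lam j (fl_d f lam i g)"
proof -
  have "fderiv i (mfract_of (mconst lam) * (mfract_of (mderiv j f) / mfract_of f))
     = fderiv j (mfract_of (mconst lam) * (mfract_of (mderiv i f) / mfract_of f))"
    using fderiv_log_symmetric[OF assms, of i j]
    by (simp only: fderiv_mult fderiv_of mderiv_mconst mfract_of_zero mult_zero_left)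
  then show ?thesis
    unfolding fl_d_def times_divide_eq_right[symmetric]
    by (simp add: fderiv_add fderiv_mult fderiv_commute[of i j] algebra_simps
        del: times_divide_eq_left times_divide_eq_right)
qed


section \<open>The tensor products and the \<open>b\<close>-function\<close>

text \<open>
  In the following, \<open>act\<close> is the action of the Weyl algebra on \<open>M\<close>; \<open>mfs\<close> stands for
  \<open>M \<otimes> K[x,f\<^sup>-\<^sup>1,s]f\<^sup>s\<close> and \<open>mfl\<close> for \<open>M \<otimes> K[x,f\<^sup>-\<^sup>1]f\<^sup>\<lambda>\<close>.  The underlying group of the latter does not depend
  on \<open>\<lambda>\<close>, only the action does.
\<close>

definition mfs_class where
  "mfs_class act f = tens_class (\<lambda>a. act (weyl_of a)) fs_scale (fs_carrier f)"

definition mfs_tensor where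
  "mfs_tensor act f v w = mfs_class act f (frag_of (v, w))"

definition mfs_space where
  "mfs_space act f = tens_space (\<lambda>a. act (weyl_of a)) fs_scale (fs_carrier f)"

definition mfs_act where
  "mfs_act act f Q = tens_op (\<lambda>a. act (weyl_of a)) fs_scale (fs_carrier f)
     (nfs_act (tens_sm fs_scale) (tens_d (\<lambda>i. act (weyl_d i)) (fs_d f)) (tens_s fs_s) Q)"

definition mfl_class where
  "mfl_class act f = tens_class (\<lambda>a. act (weyl_of a)) fl_scale (loc_ring f)"

definition mfl_tensor where
  "mfl_tensor act f v w = mfl_class act f (frag_of (v, w))"

definition mfl_space where
  "mfl_space act f = tens_space (\<lambda>a. act (weyl_of a)) fl_scale (loc_ring f)"

definition mfl_act where
  "mfl_act act f lam P = tens_op (\<lambda>a. act (weyl_of a)) fl_scale (loc_ring f)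
     (nf_act (tens_sm fl_scale) (tens_d (\<lambda>i. act (weyl_d i)) (fl_d f lam)) (weyl_nf P))"

definition b_equation ::
  "(('n::{finite,linorder}, 'k::field_char_0) weyl \<Rightarrow> 'm \<Rightarrow> 'm::ab_group_add) \<Rightarrow> 'm \<Rightarrow> ('n, 'k) mpoly \<Rightarrow> 'k poly \<Rightarrow> bool" where
  "b_equation act u f b \<longleftrightarrow>
     mfs_act act f (weyl_s_of_poly b) (mfs_tensor act f u (fs_pow f 0))
       \<in> cyclic (mfs_act act f) (mfs_tensor act f u (fs_pow f 1))"

definition b_function_exists where
  "b_function_exists act u f \<longleftrightarrow> (\<exists>b. b \<noteq> 0 \<and> b_equation act u f b)"

text \<open>\<open>b_function\<close> is meaningful only if \<open>b_function_exists\<close> holds.\<close>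

definition b_function where
  "b_function act u f = (THE b. lead_coeff b = 1 \<and> b_equation act u f b \<and>
     (\<forall>c. c \<noteq> 0 \<and> b_equation act u f c \<longrightarrow> degree b \<le> degree c))"


subsection \<open>The two actions are well-defined module structures\<close>

text \<open>
  \<open>tens_op\<close> takes a union over representatives; it is a coset because the operations respect
  \<open>tens_rel\<close>.
\<close>

lemma tens_fs:
  fixes act :: "('n::{finite,linorder}, 'k::idom) weyl \<Rightarrow> 'm::ab_group_add \<Rightarrow> 'm"
  assumes "left_module act" "f \<noteq> 0"
  shows "tens (\<lambda>a. act (weyl_of a)) (\<lambda>i. act (weyl_d i)) fs_scale (fs_d f) (fs_carrier f)"
proof -
  interpret left_module act by fact
  show ?thesis
  proof
    fix a b :: "('n, 'k) mpoly" and i j :: 'n and v v' :: 'm and w w' :: "('n, 'k) mfract poly"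
    show "act (weyl_of a) (v + v') = act (weyl_of a) v + act (weyl_of a) v'"
      and "act (weyl_d i) (v + v') = act (weyl_d i) v + act (weyl_d i) v'" by (rule act_add)+
    show "act (weyl_d i) (act (weyl_of a) v) = act (weyl_of (mderiv i a)) v + act (weyl_of a) (act (weyl_d i) v)"
      by (simp add: weyl_d_weyl_of act_add_left add.commute flip: act_mult)
    show "act (weyl_d i) (act (weyl_d j) v) = act (weyl_d j) (act (weyl_d i) v)"
      by (simp add: weyl_d_commute[of i j] flip: act_mult)
    show "fs_scale a w \<in> fs_carrier f" if "w \<in> fs_carrier f"
      using that by (simp add: fs_scale_def fs_carrier_def loc_ring_mult loc_ring_of)
    show "fs_d f i w \<in> fs_carrier f" if "w \<in> fs_carrier f"
      using fs_d_carrier assms(2) that .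
    show "fs_d f i (w + w') = fs_d f i w + fs_d f i w'"
      by (rule poly_eqI) (simp add: fs_d_def coeff_map_poly fderiv_add algebra_simps smult_add_right)
    show "fs_d f i (fs_scale a w) = fs_scale (mderiv i a) w + fs_scale a (fs_d f i w)"
    proof (rule poly_eqI)
      fix n
      show "coeff (fs_d f i (fs_scale a w)) n = coeff (fs_scale (mderiv i a) w + fs_scale a (fs_d f i w)) n"
        by (cases n) (simp_all add: fs_d_def fs_scale_def coeff_map_poly fderiv_mult fderiv_of algebra_simps)
    qed
    show "fs_d f i (fs_d f j w) = fs_d f j (fs_d f i w)" using fs_d_commute assms(2) .
  qed (simp_all add: fs_scale_def smult_add_right smult_add_left mfract_of_add mfract_of_mult)
qed

lemma tens_fl:
  fixes act :: "('n::{finite,linorder}, 'k::idom) weyl \<Rightarrow> 'm::ab_group_add \<Rightarrow> 'm"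
  assumes "left_module act" "f \<noteq> 0"
  shows "tens (\<lambda>a. act (weyl_of a)) (\<lambda>i. act (weyl_d i)) fl_scale (fl_d f lam) (loc_ring f)"
proof -
  interpret left_module act by fact
  show ?thesis
  proof
    fix a b :: "('n, 'k) mpoly" and i j :: 'n and v v' :: 'm and w w' :: "('n, 'k) mfract"
    show "act (weyl_of a) (v + v') = act (weyl_of a) v + act (weyl_of a) v'"
      and "act (weyl_d i) (v + v') = act (weyl_d i) v + act (weyl_d i) v'" by (rule act_add)+
    show "act (weyl_d i) (act (weyl_of a) v) = act (weyl_of (mderiv i a)) v + act (weyl_of a) (act (weyl_d i) v)"
      by (simp add: weyl_d_weyl_of act_add_left add.commute flip: act_mult)
    show "act (weyl_d i) (act (weyl_d j) v) = act (weyl_d j) (act (weyl_d i) v)"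
      by (simp add: weyl_d_commute[of i j] flip: act_mult)
    show "fl_scale a w \<in> loc_ring f" if "w \<in> loc_ring f"
      using that by (simp add: fl_scale_def loc_ring_mult loc_ring_of)
    show "fl_d f lam i w \<in> loc_ring f" if "w \<in> loc_ring f"
    proof -
      have "mfract_of (mconst lam * mderiv i f) * w / mfract_of f \<in> loc_ring f"
        using that by (rule loc_ring_divide)
      then show ?thesis
        using loc_ring_add[OF assms(2) loc_ring_fderiv[OF assms(2) that]]
        by (simp add: fl_d_def mfract_of_mult)
    qed
    show "fl_d f lam i (fl_d f lam j w) = fl_d f lam j (fl_d f lam i w)" using fl_d_commute assms(2) .
  qed (simp_all add: fl_scale_def fl_d_def fderiv_add fderiv_mult fderiv_of mfract_of_add mfract_of_mult
      algebra_simps add_divide_distrib)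
qed

lemma rep_mfs:
  fixes act :: "('n::{finite,linorder}, 'k::idom) weyl \<Rightarrow> 'm::ab_group_add \<Rightarrow> 'm"
  assumes "left_module act" "f \<noteq> 0"
  shows "weyl_rep_s (tens_rel (\<lambda>a. act (weyl_of a)) fs_scale (fs_carrier f)) (tens_free (fs_carrier f))
    (tens_sm fs_scale) (tens_d (\<lambda>i. act (weyl_d i)) (fs_d f)) (tens_s fs_s)"
proof -
  interpret tens "\<lambda>a. act (weyl_of a)" "\<lambda>i. act (weyl_d i)" fs_scale "fs_d f" "fs_carrier f"
    using assms by (rule tens_fs)
  have B: "fs_s w \<in> fs_carrier f" if "w \<in> fs_carrier f" for w
    using that loc_ring_0 by (auto simp: fs_s_def fs_carrier_def coeff_pCons split: nat.split)
  show ?thesis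
  proof
    fix a b :: "('n, 'k) mpoly" and x y :: "('m \<times> ('n, 'k) mfract poly) \<Rightarrow>\<^sub>0 int" and i :: 'n
    show "tens_s fs_s (x + y) = tens_s fs_s x + tens_s fs_s y" by (simp add: tens_s_def frag_extend_add)
    show "tens_s fs_s x \<in> N" if "x \<in> N"
      unfolding tens_s_def
    proof (rule frag_extend_N[OF _ _ _ that], goal_cases)
      case (1 v v' w)
      then show ?case using tens_rel.add_left[OF B] by simp
    next
      case (2 v w w')
      then show ?case using tens_rel.add_right[OF B B] by (simp add: fs_s_def smult_add_right)
    next
      case (3 a v w)
      have "fs_s (fs_scale a w) = fs_scale a (fs_s w)" by (simp add: fs_s_def fs_scale_def)
      then show ?case using tens_rel.balanced[OF B] 3 by simp
    qed
    show "tens_s fs_s x \<in> F" if "x \<in> F"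
      unfolding tens_s_def by (rule frag_extend_F[OF _ that]) (auto intro: F_of B)
    show "tens_s fs_s (tens_sm fs_scale a x) - tens_sm fs_scale a (tens_s fs_s x) \<in> N" if "x \<in> F"
      by (rule frag_extend_rel[OF _ _ that])
        (auto simp: tens_s_def tens_sm_def frag_extend_diff fs_s_def fs_scale_def tens_rel.zero)
    have c: "fs_s (fs_d f i w) = fs_d f i (fs_s w)" for w
      by (rule poly_eqI) (simp add: fs_s_def fs_d_def coeff_map_poly coeff_pCons split: nat.split)
    show "tens_s fs_s (tens_d (\<lambda>i. act (weyl_d i)) (fs_d f) i x)
        - tens_d (\<lambda>i. act (weyl_d i)) (fs_d f) i (tens_s fs_s x) \<in> N" if "x \<in> F"
      by (rule frag_extend_rel[OF _ _ that])
        (auto simp: tens_s_def tens_d_def frag_extend_diff frag_extend_add tens_rel.zero c)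
  qed
qed

context
  fixes act :: "('n::{finite,linorder}, 'k::field_char_0) weyl \<Rightarrow> 'm::ab_group_add \<Rightarrow> 'm"
    and f :: "('n, 'k) mpoly"
  assumes M: "left_module act" and f: "f \<noteq> 0"
begin

interpretation M: left_module act by (rule M)

interpretation S: tens "\<lambda>a. act (weyl_of a)" "\<lambda>i. act (weyl_d i)" fs_scale "fs_d f" "fs_carrier f"
  using M f by (rule tens_fs)

interpretation RS: weyl_rep_s "tens_rel (\<lambda>a. act (weyl_of a)) fs_scale (fs_carrier f)"
    "tens_free (fs_carrier f)" "tens_sm fs_scale" "tens_d (\<lambda>i. act (weyl_d i)) (fs_d f)" "tens_s fs_s"
  using M f by (rule rep_mfs)

interpretation L: tens "\<lambda>a. act (weyl_of a)" "\<lambda>i. act (weyl_d i)" fl_scale "fl_d f lam" "loc_ring f" for lam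
  using M f by (rule tens_fl)

lemma mfs_act_class:
  "mfs_act act f Q (mfs_class act f t) = mfs_class act f
     (nfs_act (tens_sm fs_scale) (tens_d (\<lambda>i. act (weyl_d i)) (fs_d f)) (tens_s fs_s) Q t)"
  unfolding mfs_act_def mfs_class_def by (rule S.op_class) (auto simp: RS.acts_diff RS.acts_N)

lemma mfl_act_class:
  "mfl_act act f lam P (mfl_class act f t) = mfl_class act f
     (nf_act (tens_sm fl_scale) (tens_d (\<lambda>i. act (weyl_d i)) (fl_d f lam)) (weyl_nf P) t)"
  unfolding mfl_act_def mfl_class_def
  by (rule L.op_class) (auto simp: L.rep.act_diff L.rep.act_N)

lemma mfs_act_space: "X \<in> mfs_space act f \<Longrightarrow> mfs_act act f Q X \<in> mfs_space act f"
  using mfs_act_class RS.acts_C unfolding mfs_space_def tens_space_def mfs_class_def by fastforce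

lemma mfl_act_space: "X \<in> mfl_space act f \<Longrightarrow> mfl_act act f lam Q X \<in> mfl_space act f"
  using mfl_act_class L.rep.act_C unfolding mfl_space_def tens_space_def mfl_class_def by fastforce

lemma mfs_act_mult:
  assumes "X \<in> mfs_space act f"
  shows "mfs_act act f (P * Q) X = mfs_act act f P (mfs_act act f Q X)"
proof -
  obtain t where t: "t \<in> tens_free (fs_carrier f)" "X = mfs_class act f t"
    using assms by (auto simp: mfs_space_def tens_space_def mfs_class_def)
  show ?thesis unfolding t(2) mfs_act_class
    using RS.acts_mult[OF t(1), of P Q] by (simp add: mfs_class_def S.class_eq S.rep.eqv_def)
qed

lemma mfl_act_mult:
  assumes "X \<in> mfl_space act f"
  shows "mfl_act act f lam (P * Q) X = mfl_act act f lam P (mfl_act act f lam Q X)"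
proof -
  obtain t where t: "t \<in> tens_free (loc_ring f)" "X = mfl_class act f t"
    using assms by (auto simp: mfl_space_def tens_space_def mfl_class_def)
  show ?thesis unfolding t(2) mfl_act_class
    using L.rep.weyl_act_mult[OF t(1), of lam P Q]
    by (simp add: mfl_class_def L.class_eq L.rep.eqv_def)
qed

lemma mfs_act_d:
  assumes "w \<in> fs_carrier f"
  shows "mfs_act act f (single 0 (weyl_d i)) (mfs_tensor act f v w)
    = mfs_class act f (frag_of (act (weyl_d i) v, w) + frag_of (v, fs_d f i w))"
proof -
  let ?d = "tens_d (\<lambda>i. act (weyl_d i)) (fs_d f)"
  have F: "frag_of (v, w) \<in> tens_free (fs_carrier f)" using assms by (rule S.F_of)
  have one: "S.rep.eqv (tens_sm fs_scale 1 x) x" for x :: "('m \<times> ('n, 'k) mfract poly) \<Rightarrow>\<^sub>0 int"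
    using frag_expansion[of x] by (simp add: tens_sm_def fs_scale_def case_prod_unfold)
  have "S.rep.eqv (nf_act (tens_sm fs_scale) ?d (weyl_nf (weyl_d i)) (frag_of (v, w)))
      (tens_sm fs_scale 1 (dpow ?d (0 + single i 1) (frag_of (v, w))))"
    using S.rep.act_single[OF F, of "single i 1" 1] by (simp add: weyl_d_def Weyl_inverse)
  also have "S.rep.eqv \<dots> (dpow ?d (0 + single i 1) (frag_of (v, w)))" by (rule one)
  also have "S.rep.eqv \<dots> (?d i (frag_of (v, w)))" using S.rep.dpow_step[OF F, of 0 i] by simp
  finally show ?thesis
    unfolding mfs_tensor_def mfs_act_class RS.acts_single
    by (simp add: mfs_class_def S.class_eq S.rep.eqv_def) (simp add: tens_d_def)
qed

end

end

theory Submission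
  imports Defs
begin

text \<open>
  Write \<open>N\<^sub>k = D\<^sub>X[s](u \<otimes> f\<^sup>s\<^sup>+\<^sup>k)\<close> for an integer \<open>k\<close>.  These submodules decrease with \<open>k\<close>, and they exhaust
  \<open>M \<otimes> K[x,f\<^sup>-\<^sup>1,s]f\<^sup>s\<close> (lemma \<open>FS_exhausted\<close>), because \<open>u\<close> generates \<open>M\<close> and the Leibniz rule rewrites
  \<open>\<partial>\<^sub>iv \<otimes> w\<close> as \<open>\<partial>\<^sub>i(v \<otimes> w) - v \<otimes> \<partial>\<^sub>iw\<close>.  Replacing \<open>s\<close> by \<open>s + k\<close> is \<open>D\<^sub>X\<close>-linear, so a polynomial \<open>b\<close>
  satisfying the functional equation gives \<open>b(s + k) N\<^sub>k \<subseteq> N\<^sub>k\<^sub>+\<^sub>1\<close> for every \<open>k\<close> (\<open>smult_s_shifted_G\<close>).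
  Specialization \<open>f\<^sup>s \<mapsto> f\<^sup>\<lambda>\<^sup>+\<^sup>j\<close> is also \<open>D\<^sub>X\<close>-linear and maps \<open>N\<^sub>k\<close> onto \<open>D\<^sub>X(u \<otimes> f\<^sup>\<lambda>\<^sup>+\<^sup>j\<^sup>+\<^sup>k)\<close>.

  If \<open>b\<close> has no root \<open>\<lambda> - k\<close> with \<open>k > 0\<close>, specializing the functional equation at \<open>s = \<lambda> - k\<close> gives
  \<open>u \<otimes> f\<^sup>\<lambda>\<^sup>-\<^sup>k \<in> D\<^sub>X(u \<otimes> f\<^sup>\<lambda>\<^sup>-\<^sup>k\<^sup>+\<^sup>1)\<close>, and so all \<open>u \<otimes> f\<^sup>\<lambda>\<^sup>-\<^sup>k\<close> lie in \<open>D\<^sub>X(u \<otimes> f\<^sup>\<lambda>)\<close>.  By the Leibniz rule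
  they generate everything (\<open>generated_if_no_root\<close>).

  Conversely, let \<open>b\<close> be the \<open>b\<close>-function, let \<open>u \<otimes> f\<^sup>\<lambda>\<close> be a generator, and suppose that \<open>b\<close> has a root
  \<open>\<mu> = \<lambda> - k\<close> with \<open>k > 0\<close>.  Take the largest such \<open>k\<close> and write \<open>b = (s - \<mu>)c\<close>.  As \<open>u \<otimes> f\<^sup>\<mu>\<close> lies in
  \<open>D\<^sub>X(u \<otimes> f\<^sup>\<mu>\<^sup>+\<^sup>k)\<close>, there is a \<open>z \<in> N\<^sub>k\<close> such that \<open>u \<otimes> f\<^sup>s - z\<close> vanishes at \<open>s = \<mu>\<close>.  Then
  \<open>u \<otimes> f\<^sup>s - z = (s - \<mu>)w\<close> for some \<open>w\<close> (\<open>spec_kernel\<close>).  The crux is that \<open>w \<in> N\<^sub>0\<close>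
  (\<open>linear_factor_cancel\<close>): \<open>w\<close> lies in some \<open>N\<^sub>-\<^sub>n\<close>, both \<open>s - \<mu>\<close> and \<open>b(s - n)\<close> take it into \<open>N\<^sub>-\<^sub>n\<^sub>+\<^sub>1\<close>,
  and these two polynomials are coprime because \<open>b(\<mu> - n) \<noteq> 0\<close> by the choice of \<open>k\<close>; so \<open>n\<close> can be lowered
  to \<open>0\<close>.  Now \<open>c(s)(u \<otimes> f\<^sup>s) = c(s)z + b(s)w\<close> lies in \<open>N\<^sub>1\<close>, which contradicts the minimality of the degree
  of \<open>b\<close> (\<open>b_equation_divide_linear\<close>).

  All computations take place on representatives in the free abelian groups whose quotients are the
  tensor products, modulo the congruence \<open>eqv\<close>.
\<close>

section \<open>Constants and polynomials in \<open>s\<close>\<close>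

definition kconst :: "'k \<Rightarrow> ('n::linorder, 'k::idom) mfract" where
  "kconst c = mfract_of (mconst c)"

lemma mconst_add: "mconst (a + b) = mconst a + mconst b"
  and mconst_mult: "mconst (a * b) = mconst a * (mconst b :: ('n, 'k::comm_ring_1) mpoly)"
  and mconst_zero [simp]: "mconst 0 = 0"
  and mconst_one [simp]: "mconst 1 = 1"
  by (simp_all add: mconst_def single_add mult_single)

lemma kconst_zero [simp]: "kconst 0 = 0"
  and kconst_one [simp]: "kconst 1 = 1"
  and kconst_add: "kconst (a + b) = kconst a + kconst b"
  and kconst_mult: "kconst (a * b) = kconst a * kconst b"
  and kconst_loc_ring: "kconst c \<in> loc_ring f"
  and fderiv_kconst [simp]: "fderiv i (kconst c) = 0"
  by (simp_all add: kconst_def mconst_add mconst_mult mfract_of_add mfract_of_mult loc_ring_of fderiv_of)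

lemma kconst_uminus: "kconst (- a) = - kconst a"
  using kconst_add[of a "- a"] by (simp add: eq_neg_iff_add_eq_0 add.commute)

lemma kconst_of_nat: "kconst (of_nat k) = of_nat k"
  by (induction k) (simp_all add: kconst_add)

lemma kconst_of_int: "kconst (of_int k) = of_int k"
  by (cases k rule: int_cases2) (simp_all add: kconst_uminus kconst_of_nat)

definition kpoly :: "'k poly \<Rightarrow> ('n::linorder, 'k::idom) mfract poly" where
  "kpoly b = map_poly kconst b"

lemma kpoly_zero [simp]: "kpoly 0 = 0"
  and kpoly_pCons [simp]: "kpoly (pCons c b) = pCons (kconst c) (kpoly b)"
  and coeff_kpoly: "coeff (kpoly b) j = kconst (coeff b j)"
  by (simp_all add: kpoly_def map_poly_pCons coeff_map_poly)

lemma kpoly_add: "kpoly (a + b) = kpoly a + kpoly b"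
  by (rule poly_eqI) (simp add: coeff_kpoly kconst_add)

lemma kpoly_smult: "kpoly (smult c b) = smult (kconst c) (kpoly b)"
  by (rule poly_eqI) (simp add: coeff_kpoly kconst_mult)

lemma kpoly_mult: "kpoly (a * b) = kpoly a * kpoly b"
  by (induction a) (simp_all add: kpoly_add kpoly_smult)

lemma kpoly_pcompose: "kpoly (pcompose a b) = pcompose (kpoly a) (kpoly b)"
  by (induction a) (simp_all add: pcompose_pCons kpoly_add kpoly_mult)

lemma poly_kpoly: "poly (kpoly b) (kconst c) = kconst (poly b c)"
  by (induction b) (simp_all add: kconst_add kconst_mult)

lemma map_poly_fderiv_pCons: "map_poly (fderiv i) (pCons a g) = pCons (fderiv i a) (map_poly (fderiv i) g)"
  by (simp add: map_poly_pCons)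

lemma map_poly_fderiv_add: "map_poly (fderiv i) (p + q) = map_poly (fderiv i) p + map_poly (fderiv i) q"
  by (rule poly_eqI) (simp add: coeff_map_poly fderiv_add)

lemma map_poly_fderiv_smult:
  "map_poly (fderiv i) (smult a q) = smult (fderiv i a) q + smult a (map_poly (fderiv i) q)"
  by (rule poly_eqI) (simp add: coeff_map_poly fderiv_mult)

lemma map_poly_fderiv_mult:
  "map_poly (fderiv i) (p * q) = map_poly (fderiv i) p * q + p * map_poly (fderiv i) q"
  by (induction p)
    (simp_all add: map_poly_fderiv_add map_poly_fderiv_smult map_poly_fderiv_pCons algebra_simps)

lemma map_poly_fderiv_kpoly [simp]: "map_poly (fderiv i) (kpoly b) = 0"
  by (rule poly_eqI) (simp add: coeff_map_poly coeff_kpoly)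

lemma map_poly_fderiv_pcompose:
  "map_poly (fderiv i) (pcompose p (kpoly b)) = pcompose (map_poly (fderiv i) p) (kpoly b)"
  by (induction p) (simp_all add: pcompose_pCons map_poly_fderiv_add map_poly_fderiv_mult
      map_poly_fderiv_pCons)

lemma poly_map_poly_fderiv: "poly (map_poly (fderiv i) g) (kconst c) = fderiv i (poly g (kconst c))"
  by (induction g) (simp_all add: map_poly_fderiv_pCons fderiv_add fderiv_mult)

lemma fs_d_kpoly_mult: "fs_d f i (kpoly b * g) = kpoly b * fs_d f i g"
  by (simp add: fs_d_def map_poly_fderiv_mult algebra_simps)

lemma fs_carrier_zero: "0 \<in> fs_carrier f"
  by (simp add: fs_carrier_def loc_ring_0)

lemma fs_carrier_pCons: "pCons a g \<in> fs_carrier f \<longleftrightarrow> a \<in> loc_ring f \<and> g \<in> fs_carrier f"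
  unfolding fs_carrier_def mem_Collect_eq by (metis coeff_pCons_0 coeff_pCons_Suc not0_implies_Suc)

lemma fs_carrier_add: "f \<noteq> 0 \<Longrightarrow> p \<in> fs_carrier f \<Longrightarrow> q \<in> fs_carrier f \<Longrightarrow> p + q \<in> fs_carrier f"
  by (simp add: fs_carrier_def loc_ring_add)

lemma fs_carrier_smult: "a \<in> loc_ring f \<Longrightarrow> p \<in> fs_carrier f \<Longrightarrow> smult a p \<in> fs_carrier f"
  by (simp add: fs_carrier_def loc_ring_mult)

lemma fs_carrier_mult: "f \<noteq> 0 \<Longrightarrow> p \<in> fs_carrier f \<Longrightarrow> q \<in> fs_carrier f \<Longrightarrow> p * q \<in> fs_carrier f"
  by (induction p)
    (auto simp: fs_carrier_zero fs_carrier_pCons loc_ring_0 intro!: fs_carrier_add fs_carrier_smult)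

lemma fs_carrier_kpoly: "kpoly b \<in> fs_carrier f"
  by (simp add: fs_carrier_def coeff_kpoly kconst_loc_ring)

lemma fs_carrier_pcompose:
  "f \<noteq> 0 \<Longrightarrow> p \<in> fs_carrier f \<Longrightarrow> q \<in> fs_carrier f \<Longrightarrow> pcompose p q \<in> fs_carrier f"
  by (induction p)
    (auto simp: fs_carrier_zero fs_carrier_pCons pcompose_pCons intro!: fs_carrier_add fs_carrier_mult)

lemma loc_ring_poly: "f \<noteq> 0 \<Longrightarrow> g \<in> fs_carrier f \<Longrightarrow> c \<in> loc_ring f \<Longrightarrow> poly g c \<in> loc_ring f"
  by (induction g) (auto simp: fs_carrier_pCons loc_ring_0 intro!: loc_ring_add loc_ring_mult)

lemma fs_carrier_synthetic_div:
  "f \<noteq> 0 \<Longrightarrow> g \<in> fs_carrier f \<Longrightarrow> c \<in> loc_ring f \<Longrightarrow> synthetic_div g c \<in> fs_carrier f"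
  by (induction g) (auto simp: fs_carrier_pCons fs_carrier_zero loc_ring_poly)

lemma loc_ring_powi:
  assumes "f \<noteq> 0"
  shows "mfract_of f powi k \<in> loc_ring f"
proof (cases "k \<ge> 0")
  case True
  then show ?thesis using loc_ring_of[of "f ^ nat k" f] by (simp add: power_int_def mfract_of_power)
next
  case False
  then have "mfract_of f powi k = mfract_of 1 / mfract_of f ^ nat (- k)"
    by (simp add: power_int_def divide_inverse power_inverse)
  then show ?thesis unfolding loc_ring_def by blast
qed

text \<open>
  The logarithmic derivative of \<open>q\<^sup>k\<close> is \<open>k\<close> times that of \<open>q\<close>; the twists by \<open>f\<^sup>k\<close> below commute with the
  derivations of the two modules for this reason.
\<close>

lemma fderiv_powi:
  assumes "q \<noteq> 0"
  shows "fderiv i (q powi k) = of_int k * (fderiv i q / q) * q powi k"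
proof (induction k rule: int_induct[where k = 0])
  case base
  show ?case using fderiv_kconst[of i 1] by simp
next
  case (step1 k)
  then show ?case using assms by (simp add: power_int_add fderiv_mult field_simps)
next
  case (step2 k)
  have "fderiv i (q powi (k - 1) * q) = of_int k * (fderiv i q / q) * (q powi (k - 1) * q)"
    using step2.IH assms by (simp add: power_int_diff)
  then show ?case using assms by (simp add: fderiv_mult field_simps)
qed


section \<open>Shifting and specializing \<open>s\<close>\<close>

text \<open>
  On coefficients of \<open>f\<^sup>s\<close>, the substitution \<open>s \<mapsto> s + k\<close> sends \<open>g(s)f\<^sup>s\<close> to \<open>g(s + k)f\<^sup>s\<^sup>+\<^sup>k\<close>, which is why the
  factor \<open>f\<^sup>k\<close> appears.  Similarly \<open>fs_spec\<close> sets \<open>s = \<lambda> + k\<close> and rewrites \<open>f\<^sup>\<lambda>\<^sup>+\<^sup>k\<close> as \<open>f\<^sup>k f\<^sup>\<lambda>\<close>; with this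
  factor, specializations at all \<open>\<lambda> + k\<close> land in the same module.
\<close>

definition fs_shift :: "('n::linorder, 'k::field_char_0) mpoly \<Rightarrow> int \<Rightarrow> ('n, 'k) mfract poly \<Rightarrow> ('n, 'k) mfract poly" where
  "fs_shift f k g = smult (mfract_of f powi k) (pcompose g (kpoly [:of_int k, 1:]))"

definition fs_spec :: "('n::linorder, 'k::field_char_0) mpoly \<Rightarrow> 'k \<Rightarrow> int \<Rightarrow> ('n, 'k) mfract poly \<Rightarrow> ('n, 'k) mfract" where
  "fs_spec f lam k g = mfract_of f powi k * poly g (kconst (lam + of_int k))"

lemma fs_shift_add: "fs_shift f k (g + h) = fs_shift f k g + fs_shift f k h"
  by (simp add: fs_shift_def pcompose_add smult_add_right)

lemma fs_shift_scale: "fs_shift f k (fs_scale a g) = fs_scale a (fs_shift f k g)"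
  by (simp add: fs_shift_def fs_scale_def pcompose_smult mult.commute)

lemma fs_shift_s: "fs_shift f k (fs_s g) = fs_s (fs_shift f k g) + fs_scale (mconst (of_int k)) (fs_shift f k g)"
  by (simp add: fs_shift_def fs_scale_def fs_s_def pcompose_pCons kconst_def[symmetric]
      smult_add_right algebra_simps)

text \<open>
  The derivative of the factor \<open>f\<^sup>k\<close> contributes \<open>k f\<^sub>i/f\<close>, exactly the difference between the factors
  \<open>s + k\<close> and \<open>s\<close> in front of \<open>f\<^sub>i/f\<close> on the two sides.
\<close>

lemma fs_shift_d:
  assumes "f \<noteq> 0"
  shows "fs_shift f k (fs_d f i g) = fs_d f i (fs_shift f k g)"
proof -
  have nz: "mfract_of f \<noteq> 0" using assms mfract_of_eq[of f 0] by simp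
  show ?thesis
    unfolding fs_shift_def fs_d_def map_poly_fderiv_smult map_poly_fderiv_pcompose fderiv_powi[OF nz]
    by (simp add: fderiv_of pcompose_add pcompose_smult pcompose_mult pcompose_pCons kconst_of_int
        smult_add_right smult_add_left algebra_simps)
qed

lemma fs_shift_carrier: "f \<noteq> 0 \<Longrightarrow> g \<in> fs_carrier f \<Longrightarrow> fs_shift f k g \<in> fs_carrier f"
  unfolding fs_shift_def by (intro fs_carrier_smult fs_carrier_pcompose fs_carrier_kpoly loc_ring_powi)

lemma fs_spec_add: "fs_spec f lam k (g + h) = fs_spec f lam k g + fs_spec f lam k h"
  by (simp add: fs_spec_def distrib_left)

lemma fs_spec_scale: "fs_spec f lam k (fs_scale a g) = fl_scale a (fs_spec f lam k g)"
  by (simp add: fs_spec_def fs_scale_def fl_scale_def)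

lemma fs_spec_s: "fs_spec f lam k (fs_s g) = fl_scale (mconst (lam + of_int k)) (fs_spec f lam k g)"
  by (simp add: fs_spec_def fl_scale_def fs_s_def kconst_def)

lemma fs_spec_d:
  assumes "f \<noteq> 0"
  shows "fs_spec f lam k (fs_d f i g) = fl_d f lam i (fs_spec f lam k g)"
proof -
  have nz: "mfract_of f \<noteq> 0" using assms mfract_of_eq[of f 0] by simp
  show ?thesis
    unfolding fs_spec_def fs_d_def fl_d_def fderiv_mult fderiv_powi[OF nz] poly_add
      poly_map_poly_fderiv
    by (simp add: fderiv_of kconst_def[symmetric] kconst_add kconst_of_int add_divide_distrib algebra_simps)
qed

lemma fs_spec_carrier: "f \<noteq> 0 \<Longrightarrow> g \<in> fs_carrier f \<Longrightarrow> fs_spec f lam k g \<in> loc_ring f"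
  unfolding fs_spec_def by (intro loc_ring_mult loc_ring_powi loc_ring_poly kconst_loc_ring)

section \<open>Cyclic submodules by generators\<close>

text \<open>
  Polynomials and the \<open>\<partial>\<^sub>i\<close> generate the Weyl algebra; generators are added on the left, which is
  what is needed for an operator applied to a vector.
\<close>

lemma weyl_induct [case_names zero one add weyl_of weyl_d]:
  fixes P :: "('n::{finite,linorder}, 'k::comm_ring_1) weyl"
  assumes "R 0" and one: "R 1" and add: "\<And>P Q. R P \<Longrightarrow> R Q \<Longrightarrow> R (P + Q)"
    and R_of: "\<And>a P. R P \<Longrightarrow> R (weyl_of a * P)" and R_d: "\<And>i P. R P \<Longrightarrow> R (weyl_d i * P)"
  shows "R P"
proof -
  define D :: "('n \<Rightarrow>\<^sub>0 nat) \<Rightarrow> ('n, 'k) weyl" where "D \<beta> = Weyl (single \<beta> 1)" for \<beta>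
  have step: "D (single i 1 + \<beta>) = weyl_d i * D \<beta>" for i \<beta>
    by (simp add: D_def weyl_d_def times_weyl.abs_eq eq_onp_def nf_mult_d[unfolded One_nat_def]
        nf_d_single add.commute)
  have "\<forall>\<gamma>. R (D \<gamma>) \<longrightarrow> R (D (\<beta> + \<gamma>))" for \<beta>
  proof (induction \<beta> rule: pm_induct)
    case (single i k)
    show ?case
    proof (induction k)
      case (Suc k)
      have "single i (Suc k) + \<gamma> = single i 1 + (single i k + \<gamma>)" for \<gamma> :: "'n \<Rightarrow>\<^sub>0 nat"
        by (simp flip: single_add add.assoc)
      then show ?case using Suc R_d by (metis step)
    qed simp
  qed (simp_all add: add.assoc)
  moreover have "R (D 0)" using one by (simp add: D_def one_weyl_def)
  ultimately have "R (D \<beta>)" for \<beta> by (metis add.right_neutral)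
  moreover have "Weyl (single \<beta> a) = weyl_of a * D \<beta>" for \<beta> and a :: "('n, 'k) mpoly"
    by (simp add: D_def weyl_of_def times_weyl.abs_eq eq_onp_def nf_mult_def nf_act_single0
        nf_scale_eq mult_single)
  ultimately have "R (Weyl p)" for p
  proof (induction p rule: pm_induct)
    case zero
    then show ?case using assms(1) by (simp add: zero_weyl_def)
  next
    case (single \<beta> a)
    then show ?case using R_of by simp
  next
    case (add p q)
    moreover have "Weyl (p + q) = Weyl p + Weyl q" by (simp add: plus_weyl.abs_eq eq_onp_def)
    ultimately show ?case using assms(3) by simp
  qed
  then show ?thesis by (metis weyl_nf_inverse)
qed

lemma (in left_module) act_zero_left [simp]: "act 0 v = 0"
  using act_add_left[of 0 0 v] by simp

lemma cyclic_induct [consumes 2, case_names gen zero add weyl_of weyl_d]: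
  fixes act :: "('n::{finite,linorder}, 'k::comm_ring_1) weyl \<Rightarrow> 'm::ab_group_add \<Rightarrow> 'm"
  assumes "left_module act" and "v \<in> cyclic act u"
    and "R u" "R 0" "\<And>v v'. R v \<Longrightarrow> R v' \<Longrightarrow> R (v + v')"
    and "\<And>a v. R v \<Longrightarrow> R (act (weyl_of a) v)" "\<And>i v. R v \<Longrightarrow> R (act (weyl_d i) v)"
  shows "R v"
proof -
  interpret left_module act by fact
  obtain P where "v = act P u" using assms(2) by (auto simp: cyclic_def)
  moreover have "R (act P u)"
    by (induction P rule: weyl_induct) (simp_all add: assms act_one act_add_left act_mult)
  ultimately show ?thesis by simp
qed

text \<open>
  The unit law puts an element into the submodule that it generates.  For \<open>x\<close> in \<open>C\<close>, the sets \<open>gen x\<close> and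
  \<open>gens x\<close> below consist of the representatives of the cyclic submodules over \<open>D\<^sub>X\<close> and over \<open>D\<^sub>X[s]\<close>
  generated by the class of \<open>x\<close>.  Their induction rules replace normal forms of operators by closure under
  the generators of these rings.
\<close>

locale weyl_rep_unital = weyl_rep +
  assumes sm_one: "x \<in> C \<Longrightarrow> sm 1 x \<sim> x"
begin

lemma eqv_diff: "x \<sim> x' \<Longrightarrow> y \<sim> y' \<Longrightarrow> x - y \<sim> x' - y'"
  unfolding eqv_def using Nd[of "x - x'" "y - y'"] by (simp add: algebra_simps)

lemma weyl_act_of: "x \<in> C \<Longrightarrow> act (weyl_nf (weyl_of a)) x \<sim> sm a x"
  using act_single[of x 0 a] by (simp add: weyl_of_def Weyl_inverse)

lemma weyl_act_d:
  assumes "x \<in> C"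
  shows "act (weyl_nf (weyl_d i)) x \<sim> d i x"
proof -
  have "act (weyl_nf (weyl_d i)) x \<sim> sm 1 (dpow d (single i 1) x)"
    using act_single[OF assms, of "single i 1" 1] by (simp add: weyl_d_def Weyl_inverse)
  also have "\<dots> \<sim> dpow d (0 + single i 1) x" using sm_one dpow_C assms by simp
  also have "\<dots> \<sim> d i x" using dpow_step[OF assms, of 0 i] by simp
  finally show ?thesis .
qed

definition gen :: "'a \<Rightarrow> 'a set" where
  "gen x = {t. \<exists>P. t \<sim> act (weyl_nf P) x}"

lemma gen_eqv: "t \<sim> t' \<Longrightarrow> t' \<in> gen x \<Longrightarrow> t \<in> gen x"
  unfolding gen_def using eqv_trans by blast

context
  fixes x assumes x: "x \<in> C"
begin

lemma gen_self: "x \<in> gen x"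
  unfolding gen_def using eqv_trans[OF weyl_act_one[OF x] sm_one[OF x]] eqv_sym by blast

lemma gen_diff: "t \<in> gen x \<Longrightarrow> t' \<in> gen x \<Longrightarrow> t - t' \<in> gen x"
proof -
  assume "t \<in> gen x" "t' \<in> gen x"
  then obtain P Q where *: "t \<sim> act (weyl_nf P) x" "t' \<sim> act (weyl_nf Q) x" by (auto simp: gen_def)
  have "act (weyl_nf P) x \<sim> act (weyl_nf (P - Q)) x + act (weyl_nf Q) x"
    using weyl_act_add_left[OF x, of "P - Q" Q] by simp
  then have "act (weyl_nf P) x - act (weyl_nf Q) x \<sim> act (weyl_nf (P - Q)) x"
    by (simp add: eqv_def algebra_simps)
  then show ?thesis using eqv_trans[OF eqv_diff[OF *]] unfolding gen_def by blast
qed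

lemma gen_sm: "t \<in> gen x \<Longrightarrow> sm a t \<in> gen x"
proof -
  assume "t \<in> gen x"
  then obtain P where "t \<sim> act (weyl_nf P) x" by (auto simp: gen_def)
  then have "sm a t \<sim> sm a (act (weyl_nf P) x)" by (rule sm_eqv)
  also have "\<dots> \<sim> act (weyl_nf (weyl_of a * P)) x"
    using weyl_act_mult[OF x] weyl_act_of[OF act_C[OF x]] eqv_sym eqv_trans by blast
  finally show ?thesis unfolding gen_def by blast
qed

lemma gen_d: "t \<in> gen x \<Longrightarrow> d i t \<in> gen x"
proof -
  assume "t \<in> gen x"
  then obtain P where "t \<sim> act (weyl_nf P) x" by (auto simp: gen_def)
  then have "d i t \<sim> d i (act (weyl_nf P) x)" by (rule d_eqv)
  also have "\<dots> \<sim> act (weyl_nf (weyl_d i * P)) x"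
    using weyl_act_mult[OF x] weyl_act_d[OF act_C[OF x]] eqv_sym eqv_trans by blast
  finally show ?thesis unfolding gen_def by blast
qed

end

lemma gen_induct [consumes 2, case_names eqv gen diff sm d]:
  assumes x: "x \<in> C" and t: "t \<in> gen x" and eqv: "\<And>t t'. t \<sim> t' \<Longrightarrow> R t' \<Longrightarrow> R t" and gen: "R x"
    and diff: "\<And>t t'. R t \<Longrightarrow> R t' \<Longrightarrow> R (t - t')"
    and sm: "\<And>a t. t \<in> C \<Longrightarrow> R t \<Longrightarrow> R (sm a t)" and d: "\<And>i t. t \<in> C \<Longrightarrow> R t \<Longrightarrow> R (d i t)"
  shows "R t"
proof -
  have "R (act (weyl_nf P) x)" for P
  proof (induction P rule: weyl_induct)
    case zero
    then show ?case using diff[OF gen gen] by (simp add: zero_weyl.rep_eq act_zero)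
  next
    case one
    then show ?case using eqv[OF eqv_trans[OF weyl_act_one[OF x] sm_one[OF x]] gen] .
  next
    case (add P Q)
    have "R (0 - act (weyl_nf Q) x)" using diff[OF diff[OF gen gen] add(2)] by simp
    from diff[OF add(1) this] show ?case using eqv[OF weyl_act_add_left[OF x]] by simp
  next
    case (weyl_of a P)
    then show ?case
      using eqv weyl_act_mult[OF x] weyl_act_of[OF act_C[OF x]] sm act_C[OF x] by blast
  next
    case (weyl_d i P)
    then show ?case
      using eqv weyl_act_mult[OF x] weyl_act_d[OF act_C[OF x]] d act_C[OF x] by blast
  qed
  then show ?thesis using t eqv by (auto simp: gen_def)
qed

lemma gen_trans:
  assumes "x \<in> C" "y \<in> C" "y \<in> gen x" "t \<in> gen y"
  shows "t \<in> gen x"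
  using assms(2,4)
  by (induction rule: gen_induct) (auto intro: assms gen_eqv gen_diff gen_sm gen_d)

end

locale weyl_rep_s_unital = weyl_rep_s N C sm d s + weyl_rep_unital N C sm d for N C sm d s
begin

definition gens :: "'a \<Rightarrow> 'a set" where
  "gens x = {t. \<exists>Q. t \<sim> acts Q x}"

lemma gens_eqv: "t \<sim> t' \<Longrightarrow> t' \<in> gens x \<Longrightarrow> t \<in> gens x"
  unfolding gens_def using eqv_trans by blast

context
  fixes x assumes x: "x \<in> C"
begin

lemma gens_self: "x \<in> gens x"
proof -
  have "acts 1 x \<sim> x"
    using eqv_trans[OF weyl_act_one[OF x] sm_one[OF x]] by (simp add: acts_single flip: single_one)
  then show ?thesis unfolding gens_def using eqv_sym by blast
qed

lemma gens_diff: "t \<in> gens x \<Longrightarrow> t' \<in> gens x \<Longrightarrow> t - t' \<in> gens x"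
proof -
  assume "t \<in> gens x" "t' \<in> gens x"
  then obtain P Q where *: "t \<sim> acts P x" "t' \<sim> acts Q x" by (auto simp: gens_def)
  have "acts P x \<sim> acts (P - Q) x + acts Q x" using acts_add_left[OF x, of "P - Q" Q] by simp
  then have "acts P x - acts Q x \<sim> acts (P - Q) x" by (simp add: eqv_def algebra_simps)
  then show ?thesis using eqv_trans[OF eqv_diff[OF *]] unfolding gens_def by blast
qed

lemma gens_sm: "t \<in> gens x \<Longrightarrow> sm a t \<in> gens x"
proof -
  assume "t \<in> gens x"
  then obtain P where "t \<sim> acts P x" by (auto simp: gens_def)
  then have "sm a t \<sim> sm a (acts P x)" by (rule sm_eqv)
  also have "\<dots> \<sim> acts (single 0 (weyl_of a)) (acts P x)"
    using eqv_sym[OF weyl_act_of[OF acts_C[OF x]]] by (simp add: acts_single)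
  also have "\<dots> \<sim> acts (single 0 (weyl_of a) * P) x" by (rule eqv_sym[OF acts_mult[OF x]])
  finally show ?thesis unfolding gens_def by blast
qed

lemma gens_d: "t \<in> gens x \<Longrightarrow> d i t \<in> gens x"
proof -
  assume "t \<in> gens x"
  then obtain P where "t \<sim> acts P x" by (auto simp: gens_def)
  then have "d i t \<sim> d i (acts P x)" by (rule d_eqv)
  also have "\<dots> \<sim> acts (single 0 (weyl_d i)) (acts P x)"
    using eqv_sym[OF weyl_act_d[OF acts_C[OF x]]] by (simp add: acts_single)
  also have "\<dots> \<sim> acts (single 0 (weyl_d i) * P) x" by (rule eqv_sym[OF acts_mult[OF x]])
  finally show ?thesis unfolding gens_def by blast
qed

lemma gens_s: "t \<in> gens x \<Longrightarrow> s t \<in> gens x"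
proof -
  assume "t \<in> gens x"
  then obtain P where "t \<sim> acts P x" by (auto simp: gens_def)
  then have "s t \<sim> s (acts P x)" by (rule s_eqv)
  also have "\<dots> \<sim> s (act (weyl_nf 1) (acts P x))"
    using weyl_act_one[OF acts_C[OF x]] sm_one[OF acts_C[OF x]] by (blast intro: s_eqv eqv_sym eqv_trans)
  also have "\<dots> \<sim> acts (single 1 1 * P) x"
    using eqv_sym[OF acts_mult[OF x, of "single 1 1" P]] by (simp add: acts_single)
  finally show ?thesis unfolding gens_def by blast
qed

end

lemma gens_induct [consumes 2, case_names eqv gen diff sm d s]:
  assumes x: "x \<in> C" and t: "t \<in> gens x" and eqv: "\<And>t t'. t \<sim> t' \<Longrightarrow> R t' \<Longrightarrow> R t" and gen: "R x"
    and diff: "\<And>t t'. R t \<Longrightarrow> R t' \<Longrightarrow> R (t - t')"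
    and sm: "\<And>a t. t \<in> C \<Longrightarrow> R t \<Longrightarrow> R (sm a t)" and d: "\<And>i t. t \<in> C \<Longrightarrow> R t \<Longrightarrow> R (d i t)"
    and s: "\<And>t. t \<in> C \<Longrightarrow> R t \<Longrightarrow> R (s t)"
  shows "R t"
proof -
  have "R (acts Q x)" for Q
  proof (induction Q rule: pm_induct)
    case zero
    then show ?case using diff[OF gen gen] by (simp add: acts_zero_left)
  next
    case (single j p)
    have "act (weyl_nf p) x \<in> gen x" unfolding gen_def using eqv_refl by blast
    then have "R (act (weyl_nf p) x)"
      by (rule gen_induct[OF x]) (fact eqv gen diff sm d)+
    then have "R ((s ^^ j) (act (weyl_nf p) x))"
      by (induction j) (auto intro: s sp_C act_C x)
    then show ?case by (simp add: acts_single)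
  next
    case (add P Q)
    have "R (0 - acts Q x)" using diff[OF diff[OF gen gen] add(2)] by simp
    from diff[OF add(1) this] show ?case using eqv[OF acts_add_left[OF x]] by simp
  qed
  then show ?thesis using t eqv by (auto simp: gens_def)
qed

end

section \<open>Maps of tensor products induced by maps of the second factor\<close>

text \<open>
  For a \<open>K[x]\<close>-linear \<open>\<phi>\<close> this represents \<open>id \<otimes> \<phi>\<close>.  Shift, specialization and multiplication by elements of
  \<open>K[s]\<close> are all of this form.
\<close>

definition tmap :: "('l \<Rightarrow> 'l') \<Rightarrow> (('m \<times> 'l) \<Rightarrow>\<^sub>0 int) \<Rightarrow> (('m \<times> 'l') \<Rightarrow>\<^sub>0 int)" where
  "tmap \<phi> = frag_extend (\<lambda>(v, w). frag_of (v, \<phi> w))"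

lemma tens_sm_tmap: "tens_sm sL a = tmap (sL a)"
  and tens_s_tmap: "tens_s sS = tmap sS"
  by (simp_all add: tens_sm_def tens_s_def tmap_def)

lemma tmap_of [simp]: "tmap \<phi> (frag_of (v, w)) = frag_of (v, \<phi> w)"
  and tmap_zero [simp]: "tmap \<phi> 0 = 0"
  and tmap_diff: "tmap \<phi> (x - y) = tmap \<phi> x - tmap \<phi> y"
  and tmap_add: "tmap \<phi> (x + y) = tmap \<phi> x + tmap \<phi> y"
  by (simp_all add: tmap_def frag_extend_diff frag_extend_add)

lemma frag_pair_induct [case_names zero one diff]:
  assumes "R 0" "\<And>v w. R (frag_of (v, w))" "\<And>x y. R x \<Longrightarrow> R y \<Longrightarrow> R (x - y)"
  shows "R (x :: ('m \<times> 'l) \<Rightarrow>\<^sub>0 int)"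
  by (rule frag_induction[of x UNIV]) (use assms in auto)

lemma tmap_tmap: "tmap \<phi> (tmap \<psi> x) = tmap (\<lambda>w. \<phi> (\<psi> w)) x"
  by (induction x rule: frag_pair_induct) (simp_all add: tmap_diff)

lemma tmap_ident: "tmap (\<lambda>w. w) x = x"
  by (induction x rule: frag_pair_induct) (simp_all add: tmap_diff)

lemma tmap_tens_d:
  assumes "\<And>w. \<phi> (dL i w) = dL' i (\<phi> w)"
  shows "tmap \<phi> (tens_d dM dL i x) = tens_d dM dL' i (tmap \<phi> x)"
  unfolding tens_d_def
  by (induction x rule: frag_pair_induct) (simp_all add: tmap_diff tmap_add frag_extend_diff assms)

lemma tens_free_induct [consumes 1, case_names zero one diff]:
  assumes "x \<in> tens_free B" "R 0" "\<And>v w. w \<in> B \<Longrightarrow> R (frag_of (v, w))" "\<And>x y. R x \<Longrightarrow> R y \<Longrightarrow> R (x - y)"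
  shows "R x"
  by (rule frag_induction[of x "UNIV \<times> B"]) (use assms in \<open>auto simp: tens_free_def\<close>)

lemma tmap_tens_free:
  assumes "\<And>w. w \<in> B \<Longrightarrow> \<phi> w \<in> B'" "x \<in> tens_free B"
  shows "tmap \<phi> x \<in> tens_free B'"
  using assms(2)
proof (induction rule: tens_free_induct)
  case (diff x y)
  then show ?case using keys_diff[of "tmap \<phi> x" "tmap \<phi> y"] by (auto simp: tmap_diff tens_free_def)
qed (use assms(1) in \<open>auto simp: tens_free_def\<close>)

lemma tmap_tens_rel:
  assumes "\<And>w. w \<in> B \<Longrightarrow> \<phi> w \<in> B'"
    and "\<And>w w'. w \<in> B \<Longrightarrow> w' \<in> B \<Longrightarrow> \<phi> (w + w') = \<phi> w + \<phi> w'"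
    and "\<And>a w. w \<in> B \<Longrightarrow> \<phi> (sL a w) = sL' a (\<phi> w)"
    and "x \<in> tens_rel sM sL B"
  shows "tmap \<phi> x \<in> tens_rel sM sL' B'"
  using assms(4)
  by (induction rule: tens_rel.induct) (auto simp: tmap_diff tmap_add assms intro: tens_rel.intros)

text \<open>
  \<open>id \<otimes> (\<psi> + \<chi>)\<close> agrees with \<open>id \<otimes> \<psi> + id \<otimes> \<chi>\<close> only modulo the tensor relations.
\<close>

lemma tens_rel_tmap_add:
  assumes "\<And>w. w \<in> B \<Longrightarrow> \<psi> w \<in> B" "\<And>w. w \<in> B \<Longrightarrow> \<chi> w \<in> B"
    and "\<And>w. w \<in> B \<Longrightarrow> \<phi> w = \<psi> w + \<chi> w" and "x \<in> tens_free B"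
  shows "tmap \<phi> x - (tmap \<psi> x + tmap \<chi> x) \<in> tens_rel sM sL B"
  using assms(4)
proof (induction rule: tens_free_induct)
  case (diff x y)
  from tens_rel.diff[OF this] show ?case by (simp add: tmap_diff algebra_simps)
qed (auto simp: assms intro: tens_rel.intros)

lemma tens_free_diff: "x \<in> tens_free B \<Longrightarrow> y \<in> tens_free B \<Longrightarrow> x - y \<in> tens_free B"
  using keys_diff[of x y] by (auto simp: tens_free_def)

lemma frag_of_tens_free: "w \<in> B \<Longrightarrow> frag_of (v, w) \<in> tens_free B"
  by (simp add: tens_free_def)

text \<open>
  The identity \<open>\<partial>\<^sub>iv \<otimes> w = \<partial>\<^sub>i(v \<otimes> w) - v \<otimes> \<partial>\<^sub>iw\<close> shows that if \<open>H\<close> contains \<open>v \<otimes> w\<close> for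
  all \<open>w\<close>, it contains \<open>\<partial>\<^sub>iv \<otimes> w\<close> for all \<open>w\<close>.  The quantifier over \<open>w\<close> has to be inside the induction over \<open>v\<close>,
  since the identity uses \<open>v \<otimes> \<partial>\<^sub>iw\<close> as well.
\<close>

lemma tens_free_generated:
  assumes M: "left_module act" "cyclic act u = UNIV"
    and sL: "\<And>a w. w \<in> B \<Longrightarrow> sL a w \<in> B" and dL: "\<And>i w. w \<in> B \<Longrightarrow> dL i w \<in> B"
    and eqv: "\<And>x y. x - y \<in> tens_rel (\<lambda>a. act (weyl_of a)) sL B \<Longrightarrow> y \<in> H \<Longrightarrow> x \<in> H"
    and zero: "0 \<in> H" and diff: "\<And>x y. x \<in> H \<Longrightarrow> y \<in> H \<Longrightarrow> x - y \<in> H"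
    and d: "\<And>i x. x \<in> H \<Longrightarrow> tens_d (\<lambda>i. act (weyl_d i)) dL i x \<in> H"
    and u: "\<And>w. w \<in> B \<Longrightarrow> frag_of (u, w) \<in> H"
    and t: "t \<in> tens_free B"
  shows "t \<in> H"
proof -
  interpret left_module act by (rule M)
  have plus: "x + y \<in> H" if "x \<in> H" "y \<in> H" for x y
    using diff[OF that(1) diff[OF zero that(2)]] by simp
  have "\<forall>w\<in>B. frag_of (v, w) \<in> H" for v
  proof -
    have "v \<in> cyclic act u" using M(2) by simp
    with M(1) show ?thesis
    proof (induction rule: cyclic_induct)
      case gen
      then show ?case using u by blast
    next
      case zero
      show ?case
      proof
        fix w assume "w \<in> B"
        then have "0 - frag_of (0, w) \<in> tens_rel (\<lambda>a. act (weyl_of a)) sL B"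
          using tens_rel.add_left[of w B 0 0] by simp
        from tens_rel.diff[OF tens_rel.zero this] show "frag_of (0, w) \<in> H"
          using eqv[OF _ \<open>0 \<in> H\<close>] by simp
      qed
    next
      case (add v v')
      then show ?case using eqv[OF tens_rel.add_left] plus by blast
    next
      case (weyl_of a v)
      then show ?case using eqv[OF tens_rel.balanced] sL by blast
    next
      case (weyl_d i v)
      show ?case
      proof
        fix w assume w: "w \<in> B"
        have "tens_d (\<lambda>i. act (weyl_d i)) dL i (frag_of (v, w)) - frag_of (v, dL i w) \<in> H"
          using weyl_d w dL by (intro diff d) auto
        then show "frag_of (act (weyl_d i) v, w) \<in> H" by (simp add: tens_d_def)
      qed
    qed
  qed
  with t show ?thesis
    by (induction rule: tens_free_induct) (auto intro: zero diff)
qed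

section \<open>The filtration by the submodules \<open>D\<^sub>X[s](u \<otimes> f\<^sup>s\<^sup>+\<^sup>k)\<close>\<close>

lemma fs_scale_one: "fs_scale 1 = (\<lambda>w. w)" and fl_scale_one: "fl_scale 1 = (\<lambda>w. w)"
  by (simp_all add: fun_eq_iff fs_scale_def fl_scale_def)

text \<open>
  A cyclic module \<open>M = D\<^sub>X u\<close> with its two twisted localizations.  Names with \<open>S\<close> refer to
  \<open>M \<otimes> K[x,f\<^sup>-\<^sup>1,s]f\<^sup>s\<close> and names with \<open>L\<close> to \<open>M \<otimes> K[x,f\<^sup>-\<^sup>1]f\<^sup>\<lambda>\<close>: \<open>FS\<close> and \<open>FL\<close> are the groups of
  representatives, \<open>NS\<close> and \<open>NL\<close> the tensor relations, \<open>us k\<close> and \<open>ul k\<close> represent \<open>u \<otimes> f\<^sup>s\<^sup>+\<^sup>k\<close> and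
  \<open>u \<otimes> f\<^sup>\<lambda>\<^sup>+\<^sup>k\<close>, and \<open>G k\<close> consists of the representatives of \<open>N\<^sub>k = D\<^sub>X[s](u \<otimes> f\<^sup>s\<^sup>+\<^sup>k)\<close>.
\<close>

locale cyclic_weyl_module = left_module act
  for act :: "('n::{finite,linorder}, 'k::field_char_0) weyl \<Rightarrow> 'm::ab_group_add \<Rightarrow> 'm" +
  fixes u :: 'm and f :: "('n, 'k) mpoly" and lam :: 'k
  assumes cyc: "cyclic act u = UNIV" and f_nz: "f \<noteq> 0"
begin

abbreviation "FS \<equiv> tens_free (fs_carrier f) :: (('m \<times> ('n, 'k) mfract poly) \<Rightarrow>\<^sub>0 int) set"
abbreviation "NS \<equiv> tens_rel (\<lambda>a. act (weyl_of a)) fs_scale (fs_carrier f)"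
abbreviation "FL \<equiv> tens_free (loc_ring f) :: (('m \<times> ('n, 'k) mfract) \<Rightarrow>\<^sub>0 int) set"
abbreviation "NL \<equiv> tens_rel (\<lambda>a. act (weyl_of a)) fl_scale (loc_ring f)"
abbreviation "dS \<equiv> tens_d (\<lambda>i. act (weyl_d i)) (fs_d f)"
abbreviation "dL \<equiv> tens_d (\<lambda>i. act (weyl_d i)) (fl_d f lam)"

sublocale RS: weyl_rep_s_unital NS FS "tens_sm fs_scale" dS "tens_s fs_s"
proof -
  interpret weyl_rep_s NS FS "tens_sm fs_scale" dS "tens_s fs_s"
    using left_module_axioms f_nz by (rule rep_mfs)
  show "weyl_rep_s_unital NS FS (tens_sm fs_scale) dS (tens_s fs_s)"
    by unfold_locales (simp add: tens_sm_tmap fs_scale_one tmap_ident)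
qed

sublocale RL: weyl_rep_unital NL FL "tens_sm fl_scale" dL
proof -
  interpret L: tens "\<lambda>a. act (weyl_of a)" "\<lambda>i. act (weyl_d i)" fl_scale "fl_d f lam" "loc_ring f"
    using left_module_axioms f_nz by (rule tens_fl)
  show "weyl_rep_unital NL FL (tens_sm fl_scale) dL"
    by unfold_locales (simp add: tens_sm_tmap fl_scale_one tmap_ident)
qed

sublocale S: tens "\<lambda>a. act (weyl_of a)" "\<lambda>i. act (weyl_d i)" fs_scale "fs_d f" "fs_carrier f"
  using left_module_axioms f_nz by (rule tens_fs)

sublocale L: tens "\<lambda>a. act (weyl_of a)" "\<lambda>i. act (weyl_d i)" fl_scale "fl_d f lam" "loc_ring f"
  using left_module_axioms f_nz by (rule tens_fl)

abbreviation us :: "int \<Rightarrow> ('m \<times> ('n, 'k) mfract poly) \<Rightarrow>\<^sub>0 int" where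
  "us k \<equiv> frag_of (u, fs_pow f k)"
abbreviation ul :: "int \<Rightarrow> ('m \<times> ('n, 'k) mfract) \<Rightarrow>\<^sub>0 int" where
  "ul k \<equiv> frag_of (u, mfract_of f powi k)"
abbreviation "G k \<equiv> RS.gens (us k)"

text \<open>
  Multiplication by \<open>b(s)\<close> on the second factor instead of through \<open>weyl_s_of_poly\<close>: products of
  polynomials then act as compositions on the nose, not only modulo the tensor relations.
\<close>

definition smult_s :: "'k poly \<Rightarrow> (('m \<times> ('n, 'k) mfract poly) \<Rightarrow>\<^sub>0 int) \<Rightarrow> ('m \<times> ('n, 'k) mfract poly) \<Rightarrow>\<^sub>0 int" where
  "smult_s b = tmap (\<lambda>w. kpoly b * w)"

lemma F_nz: "mfract_of f \<noteq> 0"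
  using f_nz mfract_of_eq[of f 0] by simp

lemma us_FS: "us k \<in> FS"
  by (auto intro!: frag_of_tens_free simp: fs_pow_def fs_carrier_pCons fs_carrier_zero loc_ring_powi f_nz)

lemma ul_FL: "ul k \<in> FL"
  by (auto intro!: frag_of_tens_free simp: loc_ring_powi f_nz)

lemma smult_s_FS: "t \<in> FS \<Longrightarrow> smult_s b t \<in> FS"
  unfolding smult_s_def by (auto intro!: tmap_tens_free fs_carrier_mult fs_carrier_kpoly f_nz)

lemma smult_s_eqv: "RS.eqv t t' \<Longrightarrow> RS.eqv (smult_s b t) (smult_s b t')"
  unfolding RS.eqv_def smult_s_def tmap_diff[symmetric]
  by (rule tmap_tens_rel)
    (auto simp: fs_scale_def distrib_left intro!: fs_carrier_mult fs_carrier_kpoly f_nz)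

lemma smult_s_mult: "smult_s (a * b) t = smult_s a (smult_s b t)"
  by (simp add: smult_s_def tmap_tmap kpoly_mult mult.assoc)

lemma smult_s_const: "smult_s [:c:] t = tens_sm fs_scale (mconst c) t"
  by (simp add: smult_s_def tens_sm_tmap fs_scale_def[abs_def] kconst_def)

lemma smult_s_add_left:
  "t \<in> FS \<Longrightarrow> RS.eqv (smult_s (a + b) t) (smult_s a t + smult_s b t)"
  unfolding RS.eqv_def smult_s_def
  by (rule tens_rel_tmap_add)
    (auto simp: kpoly_add distrib_right intro!: fs_carrier_mult fs_carrier_kpoly f_nz)

lemma smult_s_diff: "smult_s b (t - t') = smult_s b t - smult_s b t'"
  by (simp add: smult_s_def tmap_diff)

lemma smult_s_pCons:
  assumes "t \<in> FS"
  shows "RS.eqv (smult_s (pCons c b) t) (tens_sm fs_scale (mconst c) t + tens_s fs_s (smult_s b t))"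
proof -
  have "smult_s (pCons 0 b) t = tens_s fs_s (smult_s b t)"
    by (simp add: smult_s_def tens_s_tmap tmap_tmap fs_s_def)
  then show ?thesis
    using smult_s_add_left[OF assms, of "[:c:]" "pCons 0 b"] by (simp add: smult_s_const)
qed

lemma G_add: "t \<in> G k \<Longrightarrow> t' \<in> G k \<Longrightarrow> t + t' \<in> G k"
  using RS.gens_diff[OF us_FS, of t k "0 - t'"] RS.gens_diff[OF us_FS, of 0 k t']
    RS.gens_diff[OF us_FS, of t k t] by simp

lemma smult_s_G: "t \<in> FS \<Longrightarrow> t \<in> G k \<Longrightarrow> smult_s b t \<in> G k"
proof (induction b)
  case 0
  have "smult_s 0 t = tens_sm fs_scale 0 t" using smult_s_const[of 0 t] by simp
  then show ?case using RS.gens_sm[OF us_FS] 0 by metis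
next
  case (pCons c b)
  then show ?case
    by (intro RS.gens_eqv[OF smult_s_pCons] G_add RS.gens_sm RS.gens_s us_FS)
qed

lemma us_step: "us k = tens_sm fs_scale f (us (k - 1))"
  using F_nz by (simp add: tens_sm_tmap fs_pow_def fs_scale_def power_int_diff)

lemma G_subset_step: "G k \<subseteq> G (k - 1)"
proof
  fix t assume "t \<in> G k"
  with us_FS show "t \<in> G (k - 1)"
  proof (induction rule: RS.gens_induct)
    case gen
    show ?case unfolding us_step[of k] by (intro RS.gens_sm RS.gens_self us_FS)
  qed (auto intro: RS.gens_eqv RS.gens_diff RS.gens_sm RS.gens_d RS.gens_s us_FS)
qed

lemma G_antimono: "k \<le> l \<Longrightarrow> G l \<subseteq> G k"
proof (induction l rule: int_ge_induct)
  case (step l)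
  then show ?case using G_subset_step[of "l + 1"] by auto
qed simp

lemma fs_shift_pow: "fs_shift f j (fs_pow f k) = fs_pow f (j + k)"
  using F_nz by (simp add: fs_shift_def fs_pow_def power_int_add)

lemma fs_spec_pow: "fs_spec f lam j (fs_pow f k) = mfract_of f powi (j + k)"
  using F_nz by (simp add: fs_spec_def fs_pow_def power_int_add)

abbreviation "shift j \<equiv> tmap (fs_shift f j) :: (('m \<times> ('n, 'k) mfract poly) \<Rightarrow>\<^sub>0 int) \<Rightarrow> _"
abbreviation "spec j \<equiv> tmap (fs_spec f lam j) :: (('m \<times> ('n, 'k) mfract poly) \<Rightarrow>\<^sub>0 int) \<Rightarrow> _"

lemma shift_eqv: "RS.eqv t t' \<Longrightarrow> RS.eqv (shift j t) (shift j t')"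
  unfolding RS.eqv_def tmap_diff[symmetric]
  by (rule tmap_tens_rel) (auto simp: fs_shift_add fs_shift_scale fs_shift_carrier f_nz)

lemma spec_eqv: "RS.eqv t t' \<Longrightarrow> RL.eqv (spec j t) (spec j t')"
  unfolding RS.eqv_def RL.eqv_def tmap_diff[symmetric]
  by (rule tmap_tens_rel) (auto simp: fs_spec_add fs_spec_scale fs_spec_carrier f_nz)

lemma fs_s_carrier: "w \<in> fs_carrier f \<Longrightarrow> fs_s w \<in> fs_carrier f"
  by (simp add: fs_s_def fs_carrier_pCons loc_ring_0)

lemma shift_s:
  assumes "t \<in> FS"
  shows "RS.eqv (shift j (tens_s fs_s t)) (tens_s fs_s (shift j t) + tens_sm fs_scale (mconst (of_int j)) (shift j t))"
  unfolding RS.eqv_def tens_s_tmap tens_sm_tmap tmap_tmap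
  by (rule tens_rel_tmap_add)
    (auto simp: assms fs_shift_s intro!: fs_s_carrier S.sL_B fs_shift_carrier f_nz)

lemma shift_G:
  assumes "t \<in> G k"
  shows "shift j t \<in> G (j + k)"
  using us_FS assms
proof (induction rule: RS.gens_induct)
  case (eqv t t')
  then show ?case using RS.gens_eqv shift_eqv by blast
next
  case gen
  show ?case by (simp add: fs_shift_pow RS.gens_self us_FS)
next
  case (diff t t')
  then show ?case by (simp add: tmap_diff RS.gens_diff us_FS)
next
  case (sm a t)
  have "shift j (tens_sm fs_scale a t) = tens_sm fs_scale a (shift j t)"
    by (simp add: tens_sm_tmap tmap_tmap fs_shift_scale)
  then show ?case using sm by (simp add: RS.gens_sm us_FS)
next
  case (d i t)
  have "shift j (dS i t) = dS i (shift j t)" by (rule tmap_tens_d) (rule fs_shift_d[OF f_nz])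
  then show ?case using d by (simp add: RS.gens_d us_FS)
next
  case (s t)
  then show ?case
    by (intro RS.gens_eqv[OF shift_s] G_add RS.gens_sm RS.gens_s us_FS)
qed

lemma spec_sm: "spec j (tens_sm fs_scale a t) = tens_sm fl_scale a (spec j t)"
  by (simp add: tens_sm_tmap tmap_tmap fs_spec_scale)

lemma spec_d: "spec j (dS i t) = dL i (spec j t)"
  by (rule tmap_tens_d) (rule fs_spec_d[OF f_nz])

text \<open>
  Specialization is semilinear along \<open>s \<mapsto> \<lambda> + j\<close>, so the submodule generated by \<open>us k\<close> over \<open>D\<^sub>X[s]\<close>
  goes into the one generated by the image over \<open>D\<^sub>X\<close>.
\<close>

lemma spec_G:
  assumes "t \<in> G k"
  shows "spec j t \<in> RL.gen (ul (j + k))"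
  using us_FS assms
proof (induction rule: RS.gens_induct)
  case (eqv t t')
  then show ?case using RL.gen_eqv spec_eqv by blast
next
  case gen
  show ?case by (simp add: fs_spec_pow RL.gen_self ul_FL)
next
  case (s t)
  have "spec j (tens_s fs_s t) = tens_sm fl_scale (mconst (lam + of_int j)) (spec j t)"
    by (simp add: tens_sm_tmap tens_s_tmap tmap_tmap fs_spec_s)
  then show ?case using s by (simp add: RL.gen_sm ul_FL)
qed (simp_all add: tmap_diff spec_sm spec_d RL.gen_diff RL.gen_sm RL.gen_d ul_FL)

text \<open>
  The generator lifts along the specialization, and specialization is \<open>D\<^sub>X\<close>-linear; so everything that
  \<open>D\<^sub>X\<close> makes from the generator lifts too.
\<close>

lemma gen_eq_spec:
  assumes "t \<in> RL.gen (ul (j + k))"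
  shows "\<exists>z\<in>FS \<inter> G k. RL.eqv t (spec j z)"
  using ul_FL assms
proof (induction rule: RL.gen_induct)
  case (eqv t t')
  then show ?case using RL.eqv_trans by blast
next
  case gen
  show ?case by (rule bexI[of _ "us k"]) (simp_all add: fs_spec_pow RS.gens_self us_FS)
next
  case (diff t t')
  then obtain z z' where "z \<in> FS \<inter> G k" "RL.eqv t (spec j z)" "z' \<in> FS \<inter> G k" "RL.eqv t' (spec j z')" by blast
  then show ?case
    by (intro bexI[of _ "z - z'"]) (auto simp: tmap_diff RL.eqv_diff RS.gens_diff us_FS tens_free_diff)
next
  case (sm a t)
  then obtain z where "z \<in> FS \<inter> G k" "RL.eqv t (spec j z)" by blast
  then show ?case
    by (intro bexI[of _ "tens_sm fs_scale a z"]) (auto simp: spec_sm RL.sm_eqv RS.gens_sm us_FS RS.sm_C)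
next
  case (d i t)
  then obtain z where "z \<in> FS \<inter> G k" "RL.eqv t (spec j z)" by blast
  then show ?case
    by (intro bexI[of _ "dS i z"]) (auto simp: spec_d RL.d_eqv RS.gens_d us_FS RS.d_C)
qed

lemma smult_s_monom: "smult_s (monom c j) t = (tens_s fs_s ^^ j) (tens_sm fs_scale (mconst c) t)"
proof (induction j)
  case (Suc j)
  have "smult_s (pCons 0 b) t = tens_s fs_s (smult_s b t)" for b
    by (simp add: smult_s_def tens_s_tmap tmap_tmap fs_s_def)
  then show ?case using Suc by (simp add: monom_Suc)
qed (simp add: monom_0 smult_s_const)

text \<open>
  The functional equation is about \<open>b(s)\<close> as an element of \<open>D\<^sub>X[s]\<close>; this passes to \<open>smult_s\<close>, where
  polynomials can be factored and divided.
\<close>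

lemma acts_weyl_s_of_poly:
  assumes "x \<in> FS"
  shows "RS.eqv (RS.acts (weyl_s_of_poly b) x) (smult_s b x)"
proof -
  have "RS.eqv (RS.acts (\<Sum>j\<in>J. single j (weyl_of (mconst (c j)))) x) (smult_s (\<Sum>j\<in>J. monom (c j) j) x)"
    if "finite J" for J and c :: "nat \<Rightarrow> 'k"
    using that
  proof (induction J)
    case empty
    have "smult_s 0 x = tens_sm fs_scale 0 x" using smult_s_const[of 0 x] by simp
    then show ?case using RS.eqv_sym[OF RS.sm_zero_left[OF assms]] by (simp add: RS.acts_zero_left)
  next
    case (insert j J)
    let ?Q = "\<lambda>J. \<Sum>j\<in>J. single j (weyl_of (mconst (c j))) :: ('n, 'k) weyl_s"
    have "RS.eqv (RS.acts (single j (weyl_of (mconst (c j)))) x) (smult_s (monom (c j) j) x)"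
      unfolding RS.acts_single smult_s_monom by (intro RS.sp_eqv RS.weyl_act_of assms)
    from RS.eqv_add[OF this insert.IH]
    have "RS.eqv (RS.acts (?Q (insert j J)) x) (smult_s (monom (c j) j) x + smult_s (\<Sum>j\<in>J. monom (c j) j) x)"
      using RS.eqv_trans[OF RS.acts_add_left[OF assms]] insert.hyps by simp
    from RS.eqv_trans[OF this RS.eqv_sym[OF smult_s_add_left[OF assms]]]
    show ?case using insert.hyps by simp
  qed
  from this[of "{..degree b}" "coeff b"] show ?thesis
    by (simp add: weyl_s_of_poly_def poly_as_sum_of_monoms)
qed

lemma b_equation_iff: "b_equation act u f b \<longleftrightarrow> smult_s b (us 0) \<in> G 1"
proof -
  have "b_equation act u f b \<longleftrightarrow> (\<exists>Q. RS.eqv (RS.acts (weyl_s_of_poly b) (us 0)) (RS.acts Q (us 1)))"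
    unfolding b_equation_def mfs_tensor_def cyclic_def mfs_act_class[OF left_module_axioms f_nz]
    by (simp add: mfs_class_def S.class_eq RS.eqv_def)
  also have "\<dots> \<longleftrightarrow> smult_s b (us 0) \<in> G 1"
    unfolding RS.gens_def using acts_weyl_s_of_poly[OF us_FS] RS.eqv_sym RS.eqv_trans by blast
  finally show ?thesis .
qed

lemma generated_by_power_iff:
  "cyclic (mfl_act act f lam) (mfl_tensor act f u 1) = mfl_space act f \<longleftrightarrow> FL \<subseteq> RL.gen (ul 0)"
proof -
  have cyc_eq: "cyclic (mfl_act act f lam) (mfl_tensor act f u 1)
      = {mfl_class act f (RL.act (weyl_nf P) (ul 0)) | P. True}"
    by (simp add: cyclic_def mfl_tensor_def mfl_act_class[OF left_module_axioms f_nz])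
  have space_eq: "mfl_space act f = mfl_class act f ` FL"
    by (simp add: mfl_space_def tens_space_def mfl_class_def)
  have class_eq: "mfl_class act f t = mfl_class act f t' \<longleftrightarrow> RL.eqv t t'" for t t'
    by (simp add: mfl_class_def L.class_eq RL.eqv_def)
  have "cyclic (mfl_act act f lam) (mfl_tensor act f u 1) \<subseteq> mfl_space act f"
    unfolding cyc_eq space_eq using RL.act_C[OF ul_FL] by blast
  moreover have "mfl_space act f \<subseteq> cyclic (mfl_act act f lam) (mfl_tensor act f u 1)
      \<longleftrightarrow> (\<forall>t\<in>FL. \<exists>P. RL.eqv t (RL.act (weyl_nf P) (ul 0)))"
    unfolding cyc_eq space_eq class_eq[symmetric] by blast
  ultimately show ?thesis unfolding RL.gen_def by blast
qed

section \<open>Generation and the functional equation\<close>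

text \<open>
  The union of the \<open>G (- n)\<close> is a submodule because they increase with \<open>n\<close>, and every coefficient of an
  element of \<open>K[x,f\<^sup>-\<^sup>1,s]\<close> is a multiple of some \<open>f\<^sup>-\<^sup>n\<close>.
\<close>

lemma FS_exhausted:
  assumes "t \<in> FS"
  shows "\<exists>n. t \<in> G (- int n)"
proof -
  let ?H = "\<Union>n. G (- int n)"
  have mono: "G (- int m) \<subseteq> G (- int n)" if "m \<le> n" for m n using that by (intro G_antimono) simp
  have H_diff: "x - y \<in> ?H" if "x \<in> ?H" "y \<in> ?H" for x y
  proof -
    obtain m n where "x \<in> G (- int m)" "y \<in> G (- int n)" using \<open>x \<in> ?H\<close> \<open>y \<in> ?H\<close> by blast
    then have "x \<in> G (- int (max m n))" "y \<in> G (- int (max m n))"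
      using mono max.cobounded1 max.cobounded2 by blast+
    then show ?thesis using RS.gens_diff[OF us_FS] by blast
  qed
  have "us 0 \<in> ?H" by (rule UN_I[of 0]) (simp_all add: RS.gens_self us_FS)
  from H_diff[OF this this] have H_0: "0 \<in> ?H" by (simp only: diff_self)
  have H_eqv: "x \<in> ?H" if "RS.eqv x y" "y \<in> ?H" for x y using that RS.gens_eqv by blast
  have "t \<in> ?H"
  proof (rule tens_free_generated[where sL = fs_scale and dL = "fs_d f",
        OF left_module_axioms cyc _ _ _ H_0 H_diff _ _ assms])
    fix x i assume "x \<in> ?H"
    then show "dS i x \<in> ?H" using RS.gens_d[OF us_FS] by blast
  next
    fix w assume "w \<in> fs_carrier f"
    then show "frag_of (u, w) \<in> ?H"
    proof (induction w)
      case 0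
      have "RS.eqv (frag_of (u, 0)) 0"
        using tens_rel.add_right[of 0 "fs_carrier f" 0 u] fs_carrier_zero[of f] RS.N_uminus
        by (fastforce simp: RS.eqv_def)
      then show ?case using H_eqv H_0 by blast
    next
      case (pCons a w)
      then have a: "a \<in> loc_ring f" and w: "w \<in> fs_carrier f" by (auto simp: fs_carrier_pCons)
      obtain a' n where a': "a = mfract_of a' / mfract_of f ^ n" using a by (auto simp: loc_ring_def)
      have "frag_of (u, [:a:]) = tens_sm fs_scale a' (us (- int n))"
        by (simp add: a' tens_sm_tmap fs_scale_def fs_pow_def power_int_minus divide_inverse)
      then have 1: "frag_of (u, [:a:]) \<in> ?H" using RS.gens_sm[OF us_FS RS.gens_self[OF us_FS]] by auto
      have "frag_of (u, fs_s w) = tens_s fs_s (frag_of (u, w))" by (simp add: tens_s_tmap)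
      then have 2: "frag_of (u, fs_s w) \<in> ?H" using pCons.IH[OF w] RS.gens_s[OF us_FS] by auto
      have "RS.eqv (frag_of (u, [:a:] + fs_s w)) (frag_of (u, [:a:]) + frag_of (u, fs_s w))"
        unfolding RS.eqv_def
        by (rule tens_rel.add_right) (auto simp: fs_carrier_pCons a fs_carrier_zero intro: fs_s_carrier w)
      moreover have "frag_of (u, [:a:]) + frag_of (u, fs_s w) \<in> ?H"
        using H_diff[OF 1 H_diff[OF H_0 2]] by simp
      ultimately have "frag_of (u, [:a:] + fs_s w) \<in> ?H" using H_eqv by blast
      moreover have "[:a:] + fs_s w = pCons a w" by (simp add: fs_s_def)
      ultimately show ?case by (simp only:)
    qed
  qed (use H_eqv in \<open>auto simp: RS.eqv_def intro: S.sL_B S.dL_B\<close>)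
  then show ?thesis by blast
qed

lemma FL_subset_gen:
  assumes "\<And>n. ul (- int n) \<in> RL.gen (ul 0)"
  shows "FL \<subseteq> RL.gen (ul 0)"
proof
  fix t assume t: "t \<in> FL"
  show "t \<in> RL.gen (ul 0)"
  proof (rule tens_free_generated[where sL = fl_scale and dL = "fl_d f lam",
        OF left_module_axioms cyc _ _ _ _ _ _ _ t])
    show "0 \<in> RL.gen (ul 0)" using RL.gen_diff[OF ul_FL RL.gen_self[OF ul_FL] RL.gen_self[OF ul_FL], of 0]
      by (simp only: diff_self)
    fix w assume "w \<in> loc_ring f"
    then obtain a n where "w = mfract_of a / mfract_of f ^ n" by (auto simp: loc_ring_def)
    then have "frag_of (u, w) = tens_sm fl_scale a (ul (- int n))"
      by (simp add: tens_sm_tmap fl_scale_def power_int_minus divide_inverse)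
    then show "frag_of (u, w) \<in> RL.gen (ul 0)" using RL.gen_sm[OF ul_FL assms] by simp
  next
    fix x y assume "x - y \<in> NL" "y \<in> RL.gen (ul 0)"
    then show "x \<in> RL.gen (ul 0)" using RL.gen_eqv by (simp add: RL.eqv_def)
  qed (use RL.gen_diff[OF ul_FL, of _ 0] RL.gen_d[OF ul_FL, of _ 0] in \<open>auto intro: L.sL_B L.dL_B\<close>)
qed

lemma smult_s_dS: "smult_s b (dS i t) = dS i (smult_s b t)"
  unfolding smult_s_def by (rule tmap_tens_d) (rule fs_d_kpoly_mult[symmetric])

lemma smult_s_sm: "smult_s b (tens_sm fs_scale a t) = tens_sm fs_scale a (smult_s b t)"
  by (simp add: smult_s_def tens_sm_tmap tmap_tmap fs_scale_def)

lemma smult_s_s: "smult_s b (tens_s fs_s t) = tens_s fs_s (smult_s b t)"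
  by (simp add: smult_s_def tens_s_tmap tmap_tmap fs_s_def)

text \<open>
  On the generator this is the functional equation with \<open>s\<close> replaced by \<open>s + k\<close>; it extends to \<open>G k\<close>
  because \<open>K[s]\<close> is central in \<open>D\<^sub>X[s]\<close>.
\<close>

lemma smult_s_shifted_G:
  assumes b: "b_equation act u f b" and t: "t \<in> G k"
  shows "smult_s (pcompose b [:of_int k, 1:]) t \<in> G (k + 1)"
  using us_FS t
proof (induction rule: RS.gens_induct)
  case (eqv t t')
  then show ?case using RS.gens_eqv smult_s_eqv by blast
next
  case gen
  have "shift k (smult_s b (us 0)) = smult_s (pcompose b [:of_int k, 1:]) (us k)"
    by (simp add: smult_s_def fs_shift_def fs_pow_def kpoly_pcompose pcompose_mult)
  then show ?case using shift_G[of "smult_s b (us 0)" 1 k] b by (simp add: b_equation_iff)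
qed (simp_all add: smult_s_diff smult_s_sm smult_s_dS smult_s_s RS.gens_diff RS.gens_sm RS.gens_d
    RS.gens_s us_FS)

lemma const_cancel:
  assumes "smult_s [:c:] t \<in> G k" "c \<noteq> 0"
  shows "t \<in> G k"
proof -
  have "tens_sm fs_scale (mconst (1 / c)) (smult_s [:c:] t) = smult_s [:1:] t"
    using assms(2) by (simp flip: smult_s_const smult_s_mult)
  also have "\<dots> = t" by (simp add: smult_s_def tmap_ident)
  finally show ?thesis using RS.gens_sm[OF us_FS assms(1)] by metis
qed

text \<open>
  The remainder of \<open>b(s - n)\<close> on division by \<open>s - \<mu>\<close> is the nonzero constant \<open>b(\<mu> - n)\<close>.  Both
  \<open>b(s - n)w\<close> and \<open>(s - \<mu>)w\<close> lie in \<open>G (- (n - 1))\<close>, hence so does \<open>w\<close>, and the index descends to \<open>0\<close>.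
\<close>

lemma linear_factor_cancel:
  assumes b: "b_equation act u f b" and nz: "\<And>j. j > 0 \<Longrightarrow> poly b (\<mu> - of_nat j) \<noteq> 0"
    and w: "w \<in> FS" and \<mu>w: "smult_s [:- \<mu>, 1:] w \<in> G 0"
  shows "w \<in> G 0"
proof -
  have "w \<in> G 0" if "w \<in> G (- int n)" for n
    using that
  proof (induction n)
    case (Suc n)
    let ?b = "pcompose b [:of_int (- int (Suc n)), 1:]"
    obtain q where q: "?b = q * [:- \<mu>, 1:] + [:poly ?b \<mu>:]"
      using synthetic_div_correct'[of \<mu> ?b] by (metis mult.commute)
    have "smult_s ?b w \<in> G (- int n)" using smult_s_shifted_G[OF b Suc.prems] by simp
    moreover have "smult_s (q * [:- \<mu>, 1:]) w \<in> G (- int n)"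
      unfolding smult_s_mult using \<mu>w G_antimono[of "- int n" 0]
      by (intro smult_s_G[OF smult_s_FS[OF w]]) auto
    moreover have "RS.eqv (smult_s [:poly ?b \<mu>:] w) (smult_s ?b w - smult_s (q * [:- \<mu>, 1:]) w)"
    proof (rule RS.eqv_sym)
      have "RS.eqv (smult_s ?b w) (smult_s (q * [:- \<mu>, 1:]) w + smult_s [:poly ?b \<mu>:] w)"
        using smult_s_add_left[OF w, of "q * [:- \<mu>, 1:]" "[:poly ?b \<mu>:]"] by (simp only: q[symmetric])
      from RS.eqv_diff[OF this RS.eqv_refl[of "smult_s (q * [:- \<mu>, 1:]) w"]]
      show "RS.eqv (smult_s ?b w - smult_s (q * [:- \<mu>, 1:]) w) (smult_s [:poly ?b \<mu>:] w)"
        by (simp only: add_diff_cancel_left')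
    qed
    ultimately have "smult_s [:poly ?b \<mu>:] w \<in> G (- int n)"
      using RS.gens_eqv RS.gens_diff[OF us_FS] by blast
    moreover have "poly ?b \<mu> \<noteq> 0" using nz[of "Suc n"] by (simp add: poly_pcompose algebra_simps)
    ultimately show ?case using Suc.IH const_cancel by blast
  qed simp
  then show ?thesis using FS_exhausted[OF w] by blast
qed

text \<open>
  Division by \<open>s - \<mu>\<close> in the second factor, with \<open>\<mu> = \<lambda> + j\<close>: \<open>g(s) = g(\<mu>) + (s - \<mu>)q(s)\<close>.  The constant part
  is the image of the specialization under a \<open>K[x]\<close>-linear section, so it vanishes modulo the tensor
  relations together with the specialization.
\<close>

lemma spec_kernel:
  assumes "t \<in> FS" "spec j t \<in> NL"
  shows "\<exists>w\<in>FS. RS.eqv t (smult_s [:- (lam + of_int j), 1:] w)"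
proof -
  let ?l = "[:- (lam + of_int j), 1:]"
  \<comment> \<open>The factor \<open>f\<^sup>-\<^sup>j\<close> cancels the twist \<open>f\<^sup>j\<close> built into the specialization.\<close>
  define \<sigma> :: "('n, 'k) mfract \<Rightarrow> ('n, 'k) mfract poly" where "\<sigma> h = [:h * mfract_of f powi (- j):]" for h
  have \<sigma>: "\<sigma> (fs_spec f lam j g) = [:poly g (kconst (lam + of_int j)):]" for g
    using F_nz by (simp add: \<sigma>_def fs_spec_def power_int_minus)
  have \<sigma>_B: "\<sigma> h \<in> fs_carrier f" if "h \<in> loc_ring f" for h
    using that by (simp add: \<sigma>_def fs_carrier_pCons fs_carrier_zero loc_ring_mult loc_ring_powi f_nz)
  have "\<exists>w\<in>FS. RS.eqv t (tmap \<sigma> (spec j t) + smult_s ?l w)"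
    using assms(1)
  proof (induction rule: tens_free_induct)
    case zero
    show ?case by (rule bexI[of _ 0]) (simp_all add: smult_s_def RS.C0)
  next
    case (one v w)
    let ?c = "kconst (lam + of_int j)" and ?q = "synthetic_div w (kconst (lam + of_int j))"
    have "(kpoly ?l :: ('n, 'k) mfract poly) = [:- ?c, 1:]" by (simp add: kconst_uminus[symmetric])
    then have w: "w = [:poly w ?c:] + kpoly ?l * ?q"
      using synthetic_div_correct'[of ?c w] by (simp only: add.commute[of "[:poly w ?c:]"])
    have q: "?q \<in> fs_carrier f" by (intro fs_carrier_synthetic_div f_nz one kconst_loc_ring)
    have "RS.eqv (frag_of (v, [:poly w ?c:] + kpoly ?l * ?q)) (frag_of (v, [:poly w ?c:]) + frag_of (v, kpoly ?l * ?q))"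
      unfolding RS.eqv_def
      by (rule tens_rel.add_right)
        (intro fs_carrier_mult f_nz q fs_carrier_kpoly | simp add: fs_carrier_pCons fs_carrier_zero loc_ring_poly f_nz one kconst_loc_ring)+
    then show ?case unfolding w[symmetric]
      by (intro bexI[of _ "frag_of (v, ?q)"]) (use q in \<open>auto simp: smult_s_def \<sigma> intro: frag_of_tens_free\<close>)
  next
    case (diff x y)
    then obtain w w' where w: "w \<in> FS" "w' \<in> FS" and
      *: "RS.eqv x (tmap \<sigma> (spec j x) + smult_s ?l w)" "RS.eqv y (tmap \<sigma> (spec j y) + smult_s ?l w')"
      by blast
    show ?case
      using w RS.eqv_diff[OF *]
      by (intro bexI[of _ "w - w'"]) (auto simp: tmap_diff smult_s_diff tens_free_diff algebra_simps)
  qed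
  then obtain w where "w \<in> FS" "RS.eqv t (tmap \<sigma> (spec j t) + smult_s ?l w)" by blast
  moreover have "tmap \<sigma> (spec j t) \<in> NS"
    by (rule tmap_tens_rel[OF _ _ _ assms(2)])
      (use \<sigma>_B in \<open>auto simp: \<sigma>_def distrib_right fl_scale_def fs_scale_def mult.assoc\<close>)
  then have "RS.eqv (tmap \<sigma> (spec j t) + smult_s ?l w) (0 + smult_s ?l w)"
    by (intro RS.eqv_add) (simp_all add: RS.eqv_def)
  ultimately show ?thesis using RS.eqv_trans by fastforce
qed

section \<open>The two implications\<close>

text \<open>
  Specializing \<open>b(s)(u \<otimes> f\<^sup>s) \<in> N\<^sub>1\<close> at \<open>s = \<lambda> - k\<close> and dividing by \<open>b(\<lambda> - k)\<close> lowers the exponent of \<open>f\<close> by one,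
  so all powers \<open>f\<^sup>\<lambda>\<^sup>-\<^sup>k\<close> are reached by induction.
\<close>

lemma generated_if_no_root:
  assumes b: "b_equation act u f b" and nz: "\<And>k. k > 0 \<Longrightarrow> poly b (lam - of_nat k) \<noteq> 0"
  shows "FL \<subseteq> RL.gen (ul 0)"
proof (rule FL_subset_gen)
  fix n
  show "ul (- int n) \<in> RL.gen (ul 0)"
  proof (induction n)
    case 0
    show ?case using RL.gen_self[OF ul_FL, of 0] by simp
  next
    case (Suc n)
    let ?j = "- int (Suc n)" and ?c = "poly b (lam - of_nat (Suc n))"
    have "spec ?j (smult_s b (us 0)) \<in> RL.gen (ul (?j + 1))"
      using b by (intro spec_G) (simp add: b_equation_iff)
    moreover have "spec ?j (smult_s b (us 0)) = tens_sm fl_scale (mconst ?c) (ul ?j)"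
    proof -
      have "lam + of_int ?j = lam - of_nat (Suc n)" by simp
      then have "poly (kpoly b) (kconst (lam + of_int ?j)) = (kconst ?c :: ('n, 'k) mfract)" by (simp only: poly_kpoly)
      then show ?thesis
        by (simp add: smult_s_def tens_sm_tmap fs_spec_def fs_pow_def fl_scale_def kconst_def[symmetric] mult.commute)
    qed
    ultimately have "tens_sm fl_scale (mconst ?c) (ul ?j) \<in> RL.gen (ul (- int n))" by simp
    from RL.gen_sm[OF ul_FL this, of "mconst (1 / ?c)"]
    have "ul ?j \<in> RL.gen (ul (- int n))"
      using nz[of "Suc n"] by (simp add: tens_sm_tmap fl_scale_def mult.assoc[symmetric]
          mfract_of_mult[symmetric] mconst_mult[symmetric] del: of_nat_Suc)
    then show ?case using RL.gen_trans[OF ul_FL ul_FL Suc.IH] by blast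
  qed
qed

text \<open>
  If \<open>u \<otimes> f\<^sup>\<lambda>\<close> generates, then \<open>u \<otimes> f\<^sup>s = z + (s - \<mu>)w\<close> with \<open>z \<in> N\<^sub>k\<close> and \<open>w \<in> N\<^sub>0\<close>.  Multiplying by \<open>c\<close> puts
  both terms into \<open>N\<^sub>1\<close>: the first since \<open>k > 0\<close>, the second by the functional equation for \<open>(s - \<mu>)c\<close>.
\<close>

lemma b_equation_divide_linear:
  assumes b: "b_equation act u f ([:- \<mu>, 1:] * c)" and \<mu>: "\<mu> = lam - of_nat k" and k: "k > 0"
    and nz: "\<And>j. j > 0 \<Longrightarrow> poly ([:- \<mu>, 1:] * c) (\<mu> - of_nat j) \<noteq> 0"
    and gen: "FL \<subseteq> RL.gen (ul 0)"
  shows "b_equation act u f c"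
proof -
  let ?b = "[:- \<mu>, 1:] * c" and ?j = "- int k"
  have "ul ?j \<in> RL.gen (ul (?j + int k))" using gen ul_FL by auto
  then obtain z where z: "z \<in> FS" "z \<in> G (int k)" and uz: "RL.eqv (ul ?j) (spec ?j z)"
    using gen_eq_spec by blast
  let ?t = "us 0 - z"
  have t: "?t \<in> FS" using us_FS z by (intro tens_free_diff)
  have "spec ?j (us 0) = ul ?j" using fs_spec_pow[of ?j 0] by simp
  then have "spec ?j ?t \<in> NL" using uz by (simp add: tmap_diff RL.eqv_def)
  moreover have \<mu>': "lam + of_int ?j = \<mu>" by (simp add: \<mu>)
  ultimately obtain w where w: "w \<in> FS" and tw: "RS.eqv ?t (smult_s [:- \<mu>, 1:] w)"
    using spec_kernel[OF t] \<mu>' by metis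
  have "z \<in> G 0" using z G_antimono[of 0 "int k"] by auto
  then have "?t \<in> G 0" by (intro RS.gens_diff RS.gens_self us_FS)
  then have "smult_s [:- \<mu>, 1:] w \<in> G 0" using tw RS.eqv_sym RS.gens_eqv by blast
  then have "w \<in> G 0" using linear_factor_cancel[OF b nz w] by blast
  then have "smult_s ?b w \<in> G 1" using smult_s_shifted_G[OF b, of w 0] by simp
  moreover have "RS.eqv (smult_s c ?t) (smult_s ?b w)"
    using smult_s_eqv[OF tw, of c] by (simp only: smult_s_mult[symmetric] mult.commute)
  ultimately have 1: "smult_s c ?t \<in> G 1" using RS.gens_eqv by blast
  have "z \<in> G 1" using z k G_antimono[of 1 "int k"] by auto
  then have "smult_s c z \<in> G 1" using z by (intro smult_s_G)
  from G_add[OF 1 this] show ?thesis by (simp add: b_equation_iff smult_s_diff)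
qed

lemma b_equation_add: "b_equation act u f a \<Longrightarrow> b_equation act u f b \<Longrightarrow> b_equation act u f (a + b)"
  unfolding b_equation_iff using RS.gens_eqv[OF smult_s_add_left[OF us_FS] G_add] .

lemma b_equation_smult: "b_equation act u f b \<Longrightarrow> b_equation act u f (smult c b)"
  unfolding b_equation_iff using RS.gens_sm[OF us_FS]
  by (simp add: smult_s_mult[of "[:c:]" b, simplified] smult_s_const)

end

text \<open>
  The polynomials satisfying the functional equation form a \<open>K\<close>-subspace: scaling gives a monic one of
  least degree, and the difference of two monic ones of least degree has smaller degree, so it is \<open>0\<close>.
\<close>

lemma b_function_properties:
  fixes act :: "('n::{finite,linorder}, 'k::field_char_0) weyl \<Rightarrow> 'm::ab_group_add \<Rightarrow> 'm"
  assumes data: "cyclic_weyl_module act u f" and ex: "b_function_exists act u f"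
  shows "lead_coeff (b_function act u f) = 1" "b_equation act u f (b_function act u f)"
    and "\<And>c. c \<noteq> 0 \<Longrightarrow> b_equation act u f c \<Longrightarrow> degree (b_function act u f) \<le> degree c"
proof -
  \<comment> \<open>The value of \<open>\<lambda>\<close> is arbitrary: the functional equation does not involve it.\<close>
  interpret cyclic_weyl_module act u f 0 by fact
  let ?P = "\<lambda>b. lead_coeff b = 1 \<and> b_equation act u f b \<and>
     (\<forall>c. c \<noteq> 0 \<and> b_equation act u f c \<longrightarrow> degree b \<le> degree c)"
  obtain b where b: "b \<noteq> 0" "b_equation act u f b"
    and min: "\<And>c. c \<noteq> 0 \<Longrightarrow> b_equation act u f c \<Longrightarrow> degree b \<le> degree c"
    using ex ex_has_least_nat[of "\<lambda>b. b \<noteq> 0 \<and> b_equation act u f b" _ degree]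
    unfolding b_function_exists_def by blast
  have P: "?P (smult (1 / lead_coeff b) b)"
    using b min by (auto intro: b_equation_smult)
  have uniq: "a = b" if a: "?P a" and b: "?P b" for a b
  proof (rule ccontr)
    assume "a \<noteq> b"
    have "a \<noteq> 0" "b \<noteq> 0" using a b by auto
    then have deg: "degree a = degree b" using a b by (simp add: order_antisym)
    have "b_equation act u f (a + smult (- 1) b)" using a b b_equation_add b_equation_smult by blast
    then have "degree a \<le> degree (a - b)" using a \<open>a \<noteq> b\<close> by simp
    moreover have "coeff (a - b) (degree a) = 0" using a b deg by simp
    moreover have "degree (a - b) \<le> degree a" using deg by (simp add: degree_diff_le)
    ultimately have "lead_coeff (a - b) = 0" by simp
    then show False using \<open>a \<noteq> b\<close> by (simp only: leading_coeff_0_iff right_minus_eq)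
  qed
  have "?P (b_function act u f)" unfolding b_function_def by (rule theI[of ?P, OF P uniq[OF _ P]])
  then show "lead_coeff (b_function act u f) = 1" "b_equation act u f (b_function act u f)"
    "\<And>c. c \<noteq> 0 \<Longrightarrow> b_equation act u f c \<Longrightarrow> degree (b_function act u f) \<le> degree c" by auto
qed

theorem theorem1p7:
  fixes act :: "('n::{finite,linorder}, 'k::field_char_0) weyl \<Rightarrow> 'm::ab_group_add \<Rightarrow> 'm"
    and u :: 'm and f :: "('n, 'k) mpoly" and lam :: 'k
  assumes "left_module act" and "cyclic act u = UNIV"
    and "\<forall>c. f \<noteq> mconst c"
    and "b_function_exists act u f"
  shows "(\<forall>k::nat. k > 0 \<longrightarrow> poly (b_function act u f) (lam - of_nat k) \<noteq> 0)
    \<longleftrightarrow> cyclic (mfl_act act f lam) (mfl_tensor act f u 1) = mfl_space act f"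
proof -
  have "f \<noteq> 0" using assms(3) mconst_zero by metis
  then have data: "cyclic_weyl_module act u f"
    using assms(1,2) by (simp add: cyclic_weyl_module_def cyclic_weyl_module_axioms_def)
  interpret cyclic_weyl_module act u f lam by (rule data)
  define b where "b = b_function act u f"
  note b = b_function_properties[OF data assms(4), folded b_def]
  have "b \<noteq> 0" using b(1) by auto
  have "poly b (lam - of_nat k) \<noteq> 0" if gen: "FL \<subseteq> RL.gen (ul 0)" and "k > 0" for k
  proof
    assume "poly b (lam - of_nat k) = 0"
    let ?K = "{k. poly b (lam - of_nat k) = 0}"
    have "finite ?K"
    proof (rule finite_imageD)
      show "finite ((\<lambda>k. lam - of_nat k) ` ?K)"
        by (rule finite_subset[OF _ poly_roots_finite[OF \<open>b \<noteq> 0\<close>]]) auto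
    qed (simp add: inj_on_def)
    \<comment> \<open>The largest index of a root, so that no \<open>\<mu> - j\<close> with \<open>j > 0\<close> is a root.\<close>
    define m where "m = Max ?K"
    have m: "m \<in> ?K" "k \<le> m" and max: "\<And>j. j \<in> ?K \<Longrightarrow> j \<le> m"
      using \<open>finite ?K\<close> \<open>poly b (lam - of_nat k) = 0\<close> Max_in[of ?K] by (auto simp: m_def)
    let ?\<mu> = "lam - of_nat m"
    obtain c where c: "b = [:- ?\<mu>, 1:] * c" using m(1) by (auto simp: poly_eq_0_iff_dvd dvd_def)
    have "poly b (?\<mu> - of_nat j) \<noteq> 0" if "j > 0" for j
      using max[of "m + j"] that by (auto simp: diff_diff_eq)
    then have "b_equation act u f c"
      using b_equation_divide_linear[of ?\<mu> c m] b(2) gen \<open>k > 0\<close> m(2) unfolding c by auto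
    moreover have "c \<noteq> 0" using \<open>b \<noteq> 0\<close> c by auto
    moreover have "degree b = Suc (degree c)" unfolding c using degree_mult_eq[of "[:- ?\<mu>, 1:]" c] \<open>c \<noteq> 0\<close> by (simp del: mult_pCons_left)
    ultimately show False using b(3)[of c] by simp
  qed
  then show ?thesis
    unfolding generated_by_power_iff b_def[symmetric] using generated_if_no_root[OF b(2)] by blast
qed

end
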